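(* Let $w$ be a nonnegative weight function on $[-1,1]$, let $n$ be a positive integer, let $x_{1,n},\dots,x_{n,n}$ be the zeros of the orthogonal polynomial $p_n$ of degree $n$ with respect to $w$, and put $u_{j,k}=x_{j,n}+x_{k,n}$, $v_{j,k}=x_{j,n}x_{k,n}$. Let $l_k(x)=\dfrac{p_n(x)}{p_n'(x_{k,n})(x-x_{k,n})}$. (i) The unique Lagrange interpolation polynomial of degree $n-1$ based on the points $(u_{j,k},v_{j,k})$, $1\le j\le k\le n$ (the nodes of the Gaussian cubature rule of degree $2n-1$ for $W_{-1/2}$) is given by $$L_nf(u,v)=\sum_{k=1}^n{\sum_{j=1}^k}'f(u_{j,k},v_{j,k})\,l_{j,k}(u,v),\qquad l_{j,k}(u,v)=l_j(x)l_k(y)+l_j(y)l_k(x),\quad u=x+y,\ v=xy,$$ where $\sum'$ means that the term with $j=k$ is divided by $2$. (ii) The unique Lagrange interpolation polynomial of degree $n-2$ based on the points $(u_{j,k},v_{j,k})$, $1\le j<k\le n$ (the nodes of the Gaussian cubature rule of degree $2n-3$ for $W_{1/2}$) is given by $$L_nf(u,v)=\sum_{k=2}^n\sum_{j=1}^{k-1}f(u_{j,k},v_{j,k})\,l_{j,k}(u,v),\qquad l_{j,k}(u,v)=\frac{l_j(x)l_k(y)-l_j(y)l_k(x)}{x-y},\quad u=x+y,\ v=xy.$$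
   Context: $\Pi_m^2$ is the space of polynomials in two variables of total degree at most $m$. For $\gamma=\pm\frac12$, $W_\gamma(u,v)$ is the weight equal to a normalization constant times $w(x)w(y)(u^2-4v)^\gamma$, with $u=x+y$, $v=xy$, on $\Omega=\{(u,v):1+u+v>0,\ 1-u+v>0,\ u^2>4v\}$, so that $\int_\Omega W_\gamma(u,v)\,du\,dv=1$. A Gaussian cubature rule of degree $2m-1$ is one with exactly $\dim\Pi_{m-1}^2=m(m+1)/2$ nodes. The symmetric polynomials in $(x,y)$ appearing in the definitions of $l_{j,k}$ are regarded as polynomials in $(u,v)=(x+y,xy)$. The Lagrange interpolation polynomial of degree $m$ based on a set of points is the polynomial in $\Pi_m^2$ agreeing with $f$ at all of these points.
   Formalization: In (ii), l_{j,k} is multiplied by (x_{j,n} - x_{k,n}): the printed formula takes the value 1/(x_{j,n} - x_{k,n}) instead of 1 at its own node, so it does not interpolate (e.g. n=2, w=1). *)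

theory Defs
  imports "HOL-Analysis.Analysis" "HOL-Computational_Algebra.Polynomial"
begin

definition weight_function :: "(real \<Rightarrow> real) \<Rightarrow> bool" where
  "weight_function w \<longleftrightarrow>
     (\<forall>t\<in>{-1..1}. 0 \<le> w t) \<and>
     set_integrable lborel {-1..1} w \<and>
     0 < (LINT t:{-1..1}|lborel. w t)"

text \<open>No normalization is imposed, so \<open>p\<close> is determined up to a nonzero constant factor; the
  zeros and the fundamental polynomials below do not depend on that factor.\<close>

definition orthogonal_poly :: "(real \<Rightarrow> real) \<Rightarrow> nat \<Rightarrow> real poly \<Rightarrow> bool" where
  "orthogonal_poly w n p \<longleftrightarrow>
     p \<noteq> 0 \<and> degree p = n \<and>
     (\<forall>q. degree q < n \<longrightarrow> (LINT t:{-1..1}|lborel. poly p t * poly q t * w t) = 0)"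

text \<open>For a zero \<open>a\<close> of \<open>p\<close> this is \<open>p(x) / (p'(a) (x - a))\<close> as a polynomial, that is, with
  the removable singularity at \<open>x = a\<close> filled in (the division by \<open>x - a\<close> is exact).\<close>

definition fund_poly :: "real poly \<Rightarrow> real \<Rightarrow> real poly" where
  "fund_poly p a = smult (1 / poly (pderiv p) a) (p div [:- a, 1:])"

text \<open>Polynomial functions of two real variables of total degree at most \<open>m\<close>. The degree
  bound is an integer so that the space for \<open>m = -1\<close> is the zero space.\<close>

definition Pi2 :: "int \<Rightarrow> (real \<times> real \<Rightarrow> real) set" where
  "Pi2 m = {P. \<exists>c :: nat \<Rightarrow> nat \<Rightarrow> real.
     P = (\<lambda>(u, v). \<Sum>(i, j)\<in>{(i, j). int (i + j) \<le> m}. c i j * u ^ i * v ^ j)}"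

definition lagrange_interpolant ::
  "int \<Rightarrow> (real \<times> real) set \<Rightarrow> (real \<times> real \<Rightarrow> real) \<Rightarrow> (real \<times> real \<Rightarrow> real) \<Rightarrow> bool" where
  "lagrange_interpolant m S f P \<longleftrightarrow> P \<in> Pi2 m \<and> (\<forall>s\<in>S. P s = f s)"

definition Omega :: "(real \<times> real) set" where
  "Omega = {(u, v). 0 < 1 + u + v \<and> 0 < 1 - u + v \<and> 4 * v < u\<^sup>2}"

text \<open>On \<open>Omega\<close> the numbers \<open>x\<close>, \<open>y\<close> with \<open>x + y = u\<close> and \<open>x y = v\<close> are the two real roots of
  \<open>t^2 - u t + v\<close>. The inequalities defining \<open>Omega\<close> also admit pairs with \<open>x, y > 1\<close> or
  \<open>x, y < -1\<close>; as \<open>w\<close> is a weight on \<open>[-1, 1]\<close>, it is extended by zero there.\<close>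

definition W_unnormalized :: "(real \<Rightarrow> real) \<Rightarrow> real \<Rightarrow> real \<times> real \<Rightarrow> real" where
  "W_unnormalized w g = (\<lambda>(u, v).
     let d = u\<^sup>2 - 4 * v;
         x = (u - sqrt d) / 2;
         y = (u + sqrt d) / 2;
         w0 = (\<lambda>t. indicator {-1..1} t * w t)
     in indicator Omega (u, v) * (w0 x * w0 y * d powr g))"

definition W :: "(real \<Rightarrow> real) \<Rightarrow> real \<Rightarrow> real \<times> real \<Rightarrow> real" where
  "W w g z = W_unnormalized w g z / (LINT z'|lborel. W_unnormalized w g z')"

text \<open>The coefficients are required to be nonzero so that every point of \<open>S\<close> really is a node.\<close>

definition cubature_rule ::
  "(real \<times> real \<Rightarrow> real) \<Rightarrow> int \<Rightarrow> (real \<times> real) set \<Rightarrow> (real \<times> real \<Rightarrow> real) \<Rightarrow> bool" where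
  "cubature_rule V d S a \<longleftrightarrow>
     finite S \<and> (\<forall>s\<in>S. a s \<noteq> 0) \<and>
     (\<forall>P\<in>Pi2 d. has_bochner_integral lborel (\<lambda>z. P z * V z) (\<Sum>s\<in>S. a s * P s))"

text \<open>\<open>S\<close> is the node set of a Gaussian cubature rule of degree \<open>2 m - 1\<close>; the number of nodes
  is the dimension of \<open>Pi2 (m - 1)\<close>.\<close>

definition gaussian_nodes :: "(real \<times> real \<Rightarrow> real) \<Rightarrow> nat \<Rightarrow> (real \<times> real) set \<Rightarrow> bool" where
  "gaussian_nodes V m S \<longleftrightarrow>
     card S = m * (m + 1) div 2 \<and> (\<exists>a. cubature_rule V (2 * int m - 1) S a)"

definition node :: "(nat \<Rightarrow> real) \<Rightarrow> nat \<Rightarrow> nat \<Rightarrow> real \<times> real" where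
  "node x j k = (x j + x k, x j * x k)"

text \<open>The fundamental interpolation polynomials, written in the variables \<open>s\<close>, \<open>t\<close> with
  \<open>u = s + t\<close> and \<open>v = s t\<close>.\<close>

definition l_plus :: "real poly \<Rightarrow> (nat \<Rightarrow> real) \<Rightarrow> nat \<Rightarrow> nat \<Rightarrow> real \<Rightarrow> real \<Rightarrow> real" where
  "l_plus p x j k s t =
     poly (fund_poly p (x j)) s * poly (fund_poly p (x k)) t +
     poly (fund_poly p (x j)) t * poly (fund_poly p (x k)) s"

text \<open>The factor \<open>x j - x k\<close> is the normalization that makes the value at the node
  \<open>(x j + x k, x j x k)\<close> equal to 1. It is missing in the source formula; without it
  the value there is \<open>1 / (x j - x k)\<close> and interpolation fails. Used only for \<open>s \<noteq> t\<close>.\<close>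

definition l_minus :: "real poly \<Rightarrow> (nat \<Rightarrow> real) \<Rightarrow> nat \<Rightarrow> nat \<Rightarrow> real \<Rightarrow> real \<Rightarrow> real" where
  "l_minus p x j k s t =
     (x j - x k) *
     ((poly (fund_poly p (x j)) s * poly (fund_poly p (x k)) t -
       poly (fund_poly p (x j)) t * poly (fund_poly p (x k)) s) / (s - t))"

end

theory Submission
  imports Defs
begin

text \<open>
  The map \<open>(x, y) \<mapsto> (x + y, x y)\<close> turns both claims into statements about symmetric and
  antisymmetric polynomials on the product grid of the zeros of \<open>p\<close>. A polynomial of total
  degree \<open>m\<close> in \<open>(u, v)\<close> becomes a symmetric polynomial of degree at most \<open>m\<close> in each of
  \<open>x\<close>, \<open>y\<close> separately (\<open>Pi2_slice\<close>), and conversely symmetric polynomials, and antisymmetric ones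
  after division by \<open>x - y\<close>, come from polynomials in \<open>(u, v)\<close> of the expected degree
  (\<open>symmetrization_in_Pi2\<close>, \<open>antisymmetrization_in_Pi2\<close>).

  Gaussian cubature: the Jacobian of the map is \<open>\<bar>x - y\<bar> = (u\<^sup>2 - 4 v)\<^bsup>1/2\<^esup>\<close>, so that the weights
  with exponent \<open>-1/2\<close> and \<open>1/2\<close> pull back to \<open>w(x) w(y)\<close> and \<open>(x - y)\<^sup>2 w(x) w(y)\<close>, up to
  constants (\<open>density_W_unnormalized\<close>). The product of two Gauss quadrature rules
  (\<open>product_quadrature\<close>) integrates these exactly, and points of the grid with the same image
  merge into one node. In the second case the factor \<open>(x - y)\<^sup>2\<close> removes the diagonal.

  Interpolation: that the \<open>l\<^bsub>j,k\<^esub>\<close> are fundamental polynomials is read off from the values of the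
  univariate ones at the zeros. For uniqueness, a polynomial in \<open>(u, v)\<close> that vanishes at the
  nodes pulls back, in the second case after multiplication by \<open>x - y\<close>, to a polynomial of
  degree less than \<open>n\<close> in each variable that vanishes on the whole grid. It is therefore zero
  (\<open>zero_on_grid\<close>), and so is the original polynomial (\<open>Pi2_eq_0\<close>).

  The univariate facts behind all this are that \<open>p\<close> has \<open>n\<close> distinct real zeros
  (\<open>card_zeros_orthogonal_poly\<close>) and that the quadrature weights at these are positive
  (\<open>christoffel_pos\<close>).
\<close>

section \<open>Bivariate polynomials and symmetric functions\<close>

lemma finite_degree_range: "finite {(i::nat, j::nat). int (i + j) \<le> m}"
  by (rule finite_subset[of _ "{..nat m} \<times> {..nat m}"]) auto

lemma Pi2_iff:
  "P \<in> Pi2 m \<longleftrightarrow> (\<exists>c. \<forall>z. P z =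
     (\<Sum>(i, j)\<in>{(i, j). int (i + j) \<le> m}. c i j * fst z ^ i * snd z ^ j))"
  unfolding Pi2_def by (auto simp: fun_eq_iff)

lemma Pi2_0: "(\<lambda>_. 0) \<in> Pi2 m"
  unfolding Pi2_iff by (rule exI[of _ "\<lambda>_ _. 0"]) simp

lemma Pi2_add: "P \<in> Pi2 m \<Longrightarrow> Q \<in> Pi2 m \<Longrightarrow> (\<lambda>z. P z + Q z) \<in> Pi2 m"
  unfolding Pi2_iff
  apply (elim exE)
  subgoal for c d
    by (rule exI[of _ "\<lambda>i j. c i j + d i j"])
      (simp add: split_def algebra_simps sum.distrib)
  done

lemma Pi2_scale: "P \<in> Pi2 m \<Longrightarrow> (\<lambda>z. a * P z) \<in> Pi2 m"
  unfolding Pi2_iff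
  apply (elim exE)
  subgoal for c
    by (rule exI[of _ "\<lambda>i j. a * c i j"]) (simp add: split_def algebra_simps sum_distrib_left)
  done

lemma Pi2_diff: "P \<in> Pi2 m \<Longrightarrow> Q \<in> Pi2 m \<Longrightarrow> (\<lambda>z. P z - Q z) \<in> Pi2 m"
  using Pi2_add[OF _ Pi2_scale[of Q m "-1"]] by simp

lemma Pi2_sum: "(\<And>i. i \<in> I \<Longrightarrow> P i \<in> Pi2 m) \<Longrightarrow> (\<lambda>z. \<Sum>i\<in>I. P i z) \<in> Pi2 m"
  by (induction I rule: infinite_finite_induct) (auto simp: Pi2_0 Pi2_add)

lemma Pi2_monomial:
  assumes "int (i + j) \<le> m"
  shows "(\<lambda>z. fst z ^ i * snd z ^ j) \<in> Pi2 m"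
proof -
  let ?I = "{(i, j). int (i + j) \<le> m}"
  have "(\<Sum>(i', j')\<in>?I. (if (i', j') = (i, j) then 1 else 0) * fst z ^ i' * snd z ^ j') =
      fst z ^ i * snd z ^ j" for z :: "real \<times> real"
  proof -
    have "(\<Sum>(i', j')\<in>?I. (if (i', j') = (i, j) then 1 else 0) * fst z ^ i' * snd z ^ j') =
        (\<Sum>q\<in>?I. if q = (i, j) then fst z ^ fst q * snd z ^ snd q else 0)"
      by (rule sum.cong) (auto split: if_splits)
    also have "\<dots> = fst z ^ i * snd z ^ j"
      using assms by (subst sum.delta[OF finite_degree_range]) auto
    finally show ?thesis .
  qed
  then show ?thesis
    unfolding Pi2_iff by (intro exI[of _ "\<lambda>i' j'. if (i', j') = (i, j) then 1 else 0"]) simp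
qed

lemma Pi2_mult_monomial:
  assumes "P \<in> Pi2 m" "m + int a + int b \<le> m'"
  shows "(\<lambda>z. fst z ^ a * snd z ^ b * P z) \<in> Pi2 m'"
proof -
  let ?I = "{(i, j). int (i + j) \<le> m}"
  obtain c where c: "\<And>z. P z = (\<Sum>(i, j)\<in>?I. c i j * fst z ^ i * snd z ^ j)"
    using assms(1) unfolding Pi2_iff by auto
  have "(\<lambda>z. fst z ^ a * snd z ^ b * P z) =
      (\<lambda>z. \<Sum>q\<in>?I. c (fst q) (snd q) * (fst z ^ (a + fst q) * snd z ^ (b + snd q)))"
    by (simp add: c fun_eq_iff sum_distrib_left split_def power_add mult_ac)
  also have "\<dots> \<in> Pi2 m'"
    using assms(2) by (intro Pi2_sum Pi2_scale Pi2_monomial) auto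
  finally show ?thesis .
qed

text \<open>Newton's recurrence \<open>p_{m+2} = u p_{m+1} - v p_m\<close> for the power sums raises the degree in
  \<open>(u, v)\<close> by one at each step.\<close>

lemma power_sum_in_Pi2:
  "\<exists>P\<in>Pi2 (int m). \<forall>s t. P (s + t, s * t) = s ^ m + t ^ m"
proof (induction m rule: induct_nat_012)
  case 0
  show ?case
    using Pi2_scale[OF Pi2_monomial[of 0 0 0], of 2] by (intro bexI) auto
next
  case 1
  show ?case
    using Pi2_monomial[of 1 0 1] by (intro bexI) auto
next
  case (ge2 m)
  then obtain P Q where P: "P \<in> Pi2 (int m)" "\<And>s t. P (s + t, s * t) = s ^ m + t ^ m"
    and Q: "Q \<in> Pi2 (int (Suc m))" "\<And>s t. Q (s + t, s * t) = s ^ Suc m + t ^ Suc m" by blast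
  have "(\<lambda>z. fst z ^ 1 * snd z ^ 0 * Q z - fst z ^ 0 * snd z ^ 1 * P z) \<in> Pi2 (int (Suc (Suc m)))"
    by (intro Pi2_diff Pi2_mult_monomial[OF P(1)] Pi2_mult_monomial[OF Q(1)]) auto
  then show ?case
    by (rule rev_bexI) (auto simp: P Q algebra_simps)
qed

text \<open>The quotients \<open>(s^m - t^m) / (s - t)\<close> are the complete homogeneous polynomials, which satisfy
  the same recurrence; their degree is \<open>m - 1\<close>, including the zero polynomial for \<open>m = 0\<close>.\<close>

lemma complete_homogeneous_in_Pi2:
  "\<exists>P\<in>Pi2 (int m - 1). \<forall>s t. (s - t) * P (s + t, s * t) = s ^ m - t ^ m"
proof (induction m rule: induct_nat_012)
  case 0
  show ?case
    using Pi2_0[of "-1"] by (intro bexI) auto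
next
  case 1
  show ?case
    using Pi2_monomial[of 0 0 0] by (intro bexI) auto
next
  case (ge2 m)
  then obtain P Q where P: "P \<in> Pi2 (int m - 1)" "\<And>s t. (s - t) * P (s + t, s * t) = s ^ m - t ^ m"
    and Q: "Q \<in> Pi2 (int (Suc m) - 1)"
      "\<And>s t. (s - t) * Q (s + t, s * t) = s ^ Suc m - t ^ Suc m" by blast
  have "(\<lambda>z. fst z ^ 1 * snd z ^ 0 * Q z - fst z ^ 0 * snd z ^ 1 * P z)
      \<in> Pi2 (int (Suc (Suc m)) - 1)"
    by (intro Pi2_diff Pi2_mult_monomial[OF P(1)] Pi2_mult_monomial[OF Q(1)]) auto
  moreover have "(s - t) * ((s + t) * Q (s + t, s * t) - s * t * P (s + t, s * t)) =
      s ^ Suc (Suc m) - t ^ Suc (Suc m)" for s t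
  proof -
    have "(s - t) * ((s + t) * Q (s + t, s * t) - s * t * P (s + t, s * t)) =
      (s + t) * ((s - t) * Q (s + t, s * t)) - s * t * ((s - t) * P (s + t, s * t))"
      by (simp only: right_diff_distrib mult_ac)
    then show ?thesis
      unfolding P(2) Q(2) by (simp add: algebra_simps)
  qed
  ultimately show ?case
    by (intro bexI[of _ "\<lambda>z. fst z ^ 1 * snd z ^ 0 * Q z - fst z ^ 0 * snd z ^ 1 * P z"]) auto
qed

lemma symmetrized_monomial_in_Pi2:
  assumes "a \<le> N" "b \<le> N"
  shows "\<exists>P\<in>Pi2 (int N). \<forall>s t. P (s + t, s * t) = s ^ a * t ^ b + t ^ a * s ^ b"
  using assms
proof (induction a b rule: linorder_wlog)
  case (le b a)
  obtain P where P: "P \<in> Pi2 (int (a - b))" "\<And>s t. P (s + t, s * t) = s ^ (a - b) + t ^ (a - b)"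
    using power_sum_in_Pi2 by blast
  have "(\<lambda>z. fst z ^ 0 * snd z ^ b * P z) \<in> Pi2 (int N)"
    using le by (intro Pi2_mult_monomial[OF P(1)]) auto
  moreover have "s ^ a = s ^ b * s ^ (a - b)" for s :: real
    using le by (simp flip: power_add)
  ultimately show ?case
    by (intro bexI[of _ "\<lambda>z. fst z ^ 0 * snd z ^ b * P z"])
      (auto simp: P(2) power_mult_distrib algebra_simps)
next
  case (sym a b)
  then show ?case by (simp add: mult.commute add.commute)
qed

lemma antisymmetrized_monomial_in_Pi2:
  assumes "a \<le> N" "b \<le> N"
  shows "\<exists>P\<in>Pi2 (int N - 1). \<forall>s t. (s - t) * P (s + t, s * t) = s ^ a * t ^ b - t ^ a * s ^ b"
  using assms
proof (induction a b rule: linorder_wlog)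
  case (le b a)
  obtain P where P: "P \<in> Pi2 (int (a - b) - 1)"
      "\<And>s t. (s - t) * P (s + t, s * t) = s ^ (a - b) - t ^ (a - b)"
    using complete_homogeneous_in_Pi2 by blast
  have "(\<lambda>z. -1 * (fst z ^ 0 * snd z ^ b * P z)) \<in> Pi2 (int N - 1)"
    using le by (intro Pi2_scale Pi2_mult_monomial[OF P(1)]) auto
  moreover have "(s - t) * (- 1 * ((s * t) ^ b * P (s + t, s * t))) =
      s ^ b * t ^ a - t ^ b * s ^ a" for s t
  proof -
    have *: "x ^ a = x ^ b * x ^ (a - b)" for x :: real
      using le by (simp flip: power_add)
    have "(s - t) * (- 1 * ((s * t) ^ b * P (s + t, s * t))) =
        - ((s * t) ^ b) * ((s - t) * P (s + t, s * t))" by simp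
    then show ?thesis
      unfolding P(2) *[of s] *[of t] by (simp add: power_mult_distrib algebra_simps)
  qed
  ultimately show ?case
    by (intro bexI[of _ "\<lambda>z. -1 * (fst z ^ 0 * snd z ^ b * P z)"]) auto
next
  case (sym b a)
  then obtain P where P: "P \<in> Pi2 (int N - 1)"
      "\<And>s t. (s - t) * P (s + t, s * t) = s ^ a * t ^ b - t ^ a * s ^ b" by blast
  have "(s - t) * (- 1 * P (s + t, s * t)) = s ^ b * t ^ a - t ^ b * s ^ a" for s t
    using P(2)[of s t] by (simp add: algebra_simps)
  then show ?case
    using Pi2_scale[OF P(1), of "-1"] by (intro bexI[of _ "\<lambda>z. -1 * P z"]) auto
qed

lemma poly_eq_sum_upto: "degree q \<le> N \<Longrightarrow> poly q s = (\<Sum>i\<le>N. coeff q i * s ^ i)" for s :: real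
  unfolding poly_altdef by (rule sum.mono_neutral_left) (auto simp: coeff_eq_0)

lemma symmetrization_in_Pi2:
  fixes q r :: "real poly"
  assumes "degree q \<le> N" "degree r \<le> N"
  shows "\<exists>P\<in>Pi2 (int N). \<forall>s t. P (s + t, s * t) = poly q s * poly r t + poly q t * poly r s"
proof -
  have "\<forall>a b. a \<le> N \<and> b \<le> N \<longrightarrow>
      (\<exists>P. P \<in> Pi2 (int N) \<and> (\<forall>s t. P (s + t, s * t) = s ^ a * t ^ b + t ^ a * s ^ b))"
    using symmetrized_monomial_in_Pi2 by blast
  then obtain M where M: "\<And>a b. a \<le> N \<Longrightarrow> b \<le> N \<Longrightarrow> M a b \<in> Pi2 (int N)"
    "\<And>a b s t. a \<le> N \<Longrightarrow> b \<le> N \<Longrightarrow> M a b (s + t, s * t) = s ^ a * t ^ b + t ^ a * s ^ b"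
    by metis
  let ?P = "\<lambda>z. \<Sum>a\<le>N. \<Sum>b\<le>N. coeff q a * coeff r b * M a b z"
  have "?P \<in> Pi2 (int N)"
    by (intro Pi2_sum Pi2_scale M) auto
  moreover have "?P (s + t, s * t) = poly q s * poly r t + poly q t * poly r s" for s t
    unfolding poly_eq_sum_upto[OF assms(1)] poly_eq_sum_upto[OF assms(2)] sum_product
    by (simp add: M(2) algebra_simps flip: sum.distrib)
  ultimately show ?thesis by (intro bexI[of _ ?P] allI)
qed

lemma antisymmetrization_in_Pi2:
  fixes q r :: "real poly"
  assumes "degree q \<le> N" "degree r \<le> N"
  shows "\<exists>P\<in>Pi2 (int N - 1). \<forall>s t.
    (s - t) * P (s + t, s * t) = poly q s * poly r t - poly q t * poly r s"
proof -
  have "\<forall>a b. a \<le> N \<and> b \<le> N \<longrightarrow> (\<exists>P. P \<in> Pi2 (int N - 1) \<and>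
      (\<forall>s t. (s - t) * P (s + t, s * t) = s ^ a * t ^ b - t ^ a * s ^ b))"
    using antisymmetrized_monomial_in_Pi2 by blast
  then obtain M where M: "\<And>a b. a \<le> N \<Longrightarrow> b \<le> N \<Longrightarrow> M a b \<in> Pi2 (int N - 1)"
    "\<And>a b s t. a \<le> N \<Longrightarrow> b \<le> N \<Longrightarrow> (s - t) * M a b (s + t, s * t) = s ^ a * t ^ b - t ^ a * s ^ b"
    by metis
  let ?P = "\<lambda>z. \<Sum>a\<le>N. \<Sum>b\<le>N. coeff q a * coeff r b * M a b z"
  have "?P \<in> Pi2 (int N - 1)"
    by (intro Pi2_sum Pi2_scale M) auto
  moreover have "(s - t) * ?P (s + t, s * t) = poly q s * poly r t - poly q t * poly r s" for s t
  proof -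
    have "(s - t) * ?P (s + t, s * t) =
        (\<Sum>a\<le>N. \<Sum>b\<le>N. coeff q a * coeff r b * ((s - t) * M a b (s + t, s * t)))"
      by (simp only: sum_distrib_left mult_ac)
    also have "\<dots> = (\<Sum>a\<le>N. \<Sum>b\<le>N. coeff q a * coeff r b * (s ^ a * t ^ b - t ^ a * s ^ b))"
      by (simp add: M(2))
    also have "\<dots> = poly q s * poly r t - poly q t * poly r s"
      unfolding poly_eq_sum_upto[OF assms(1)] poly_eq_sum_upto[OF assms(2)] sum_product
      by (simp add: right_diff_distrib sum_subtractf mult_ac)
    finally show ?thesis .
  qed
  ultimately show ?thesis by (intro bexI[of _ ?P] allI)
qed

text \<open>The case \<open>q = 0\<close> is listed separately because the degree of the zero polynomial is \<open>0\<close>, while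
  \<open>m\<close> may be negative.\<close>

lemma Pi2_slice:
  assumes "P \<in> Pi2 m"
  shows "\<exists>q. (int (degree q) \<le> m \<or> q = 0) \<and> (\<forall>s. poly q s = P (s + t, s * t))"
proof -
  let ?I = "{(i, j). int (i + j) \<le> m}"
  obtain c where c: "\<And>z. P z = (\<Sum>(i, j)\<in>?I. c i j * fst z ^ i * snd z ^ j)"
    using assms unfolding Pi2_iff by blast
  let ?q = "\<Sum>(i, j)\<in>?I. smult (c i j) ([:t, 1:] ^ i * [:0, t:] ^ j)"
  have "int (degree ?q) \<le> m \<or> ?q = 0"
  proof (cases "0 \<le> m")
    case True
    have "degree ?q \<le> nat m"
    proof (intro degree_sum_le finite_degree_range)
      fix k assume k: "k \<in> ?I"
      have "degree ([:t, 1:] ^ i * [:0, t:] ^ j) \<le> i + j" for i j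
      proof -
        have "degree [:t, 1:] * i = i" "degree [:0, t:] * j \<le> j" by auto
        then show ?thesis
          using degree_mult_le[of "[:t, 1:] ^ i" "[:0, t:] ^ j"]
            degree_power_le[of "[:t, 1:]" i] degree_power_le[of "[:0, t:]" j] by linarith
      qed
      then have "degree (smult a ([:t, 1:] ^ i * [:0, t:] ^ j)) \<le> i + j" for a i j
        by (rule order_trans[OF degree_smult_le])
      from order_trans[OF this] k
      show "degree (case k of (i, j) \<Rightarrow> smult (c i j) ([:t, 1:] ^ i * [:0, t:] ^ j)) \<le> nat m"
        by (auto simp del: degree_smult_eq)
    qed
    with True show ?thesis by linarith
  next
    case False
    then have "?I = {}" by auto
    then show ?thesis by simp
  qed
  moreover have "\<forall>s. poly ?q s = P (s + t, s * t)"
    unfolding c poly_sum by (auto simp: split_def add.commute mult_ac)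
  ultimately show ?thesis by blast
qed

lemma continuous_Pi2:
  assumes "P \<in> Pi2 m"
  shows "continuous_on UNIV P"
proof -
  obtain c where "\<And>z. P z = (\<Sum>(i, j)\<in>{(i, j). int (i + j) \<le> m}. c i j * fst z ^ i * snd z ^ j)"
    using assms unfolding Pi2_iff by blast
  then have "P = (\<lambda>z. \<Sum>(i, j)\<in>{(i, j). int (i + j) \<le> m}. c i j * fst z ^ i * snd z ^ j)"
    by (intro ext)
  then show ?thesis
    by (auto simp: split_def intro!: continuous_intros)
qed

text \<open>A polynomial that vanishes where \<open>u\<^sup>2 > 4 v\<close>, the image of the off-diagonal \<open>(s, t)\<close>, vanishes
  identically: on each vertical line it is a polynomial in \<open>v\<close> with infinitely many zeros.\<close>

lemma Pi2_eq_0: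
  assumes "P \<in> Pi2 m" and zero: "\<And>s t. s \<noteq> t \<Longrightarrow> P (s + t, s * t) = 0"
  shows "P = (\<lambda>_. 0)"
proof (rule ext, clarify)
  fix u v :: real
  let ?I = "{(i, j). int (i + j) \<le> m}"
  obtain c where c: "\<And>z. P z = (\<Sum>(i, j)\<in>?I. c i j * fst z ^ i * snd z ^ j)"
    using assms(1) unfolding Pi2_iff by auto
  define q where "q = (\<Sum>(i, j)\<in>?I. monom (c i j * u ^ i) j)"
  have q: "poly q y = P (u, y)" for y
    unfolding q_def c poly_sum by (simp add: split_def poly_monom)
  have "poly q y = 0" if "y < u\<^sup>2 / 4" for y
  proof -
    define d where "d = sqrt (u\<^sup>2 - 4 * y)"
    have "d > 0" "d\<^sup>2 = u\<^sup>2 - 4 * y" using that by (auto simp: d_def)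
    have "(u - d) / 2 + (u + d) / 2 = u" by (simp add: field_simps)
    moreover have "(u - d) / 2 * ((u + d) / 2) = (u\<^sup>2 - d\<^sup>2) / 4"
      by (simp add: field_simps power2_eq_square)
    moreover have "(u\<^sup>2 - d\<^sup>2) / 4 = y" using \<open>d\<^sup>2 = _\<close> by simp
    ultimately show ?thesis
      using zero[of "(u - d) / 2" "(u + d) / 2"] \<open>d > 0\<close> by (simp add: q)
  qed
  then have "{..<u\<^sup>2 / 4} \<subseteq> {y. poly q y = 0}" by auto
  then have "q = 0"
    using poly_roots_finite[of q] infinite_Iio[of "u\<^sup>2 / 4"] finite_subset by blast
  then show "P (u, v) = 0" using q[of v] by simp
qed

section \<open>Zeros of orthogonal polynomials\<close>

text \<open>Extending the weight by zero turns integrals over \<open>[-1, 1]\<close> into integrals over the whole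
  line, so that substitution and Fubini's theorem need no care about domains.\<close>

definition weight0 :: "(real \<Rightarrow> real) \<Rightarrow> real \<Rightarrow> real" where
  "weight0 w t = indicator {-1..1} t * w t"

lemma weight0_outside: "t \<notin> {-1..1} \<Longrightarrow> weight0 w t = 0"
  by (simp add: weight0_def)

context
  fixes w :: "real \<Rightarrow> real"
  assumes w: "weight_function w"
begin

lemma weight0_nonneg: "0 \<le> weight0 w t"
  using w by (auto simp: weight0_def weight_function_def indicator_def)

lemma weight0_integrable: "integrable lborel (weight0 w)"
  using w unfolding weight_function_def set_integrable_def
  by (auto simp: weight0_def[abs_def])

lemma weight0_measurable [measurable]: "weight0 w \<in> borel_measurable borel"
  using borel_measurable_integrable[OF weight0_integrable] by simp

lemma weight0_integral_pos: "0 < (LINT t|lborel. weight0 w t)"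
  using w unfolding weight_function_def set_lebesgue_integral_def
  by (simp add: weight0_def[abs_def])

lemma continuous_weight0_integrable:
  assumes "continuous_on UNIV (f :: real \<Rightarrow> real)"
  shows "integrable lborel (\<lambda>t. f t * weight0 w t)"
proof -
  have "compact (f ` {-1..1})"
    by (rule compact_continuous_image[OF continuous_on_subset[OF assms]]) auto
  then obtain C where C: "\<And>t. t \<in> {-1..1} \<Longrightarrow> \<bar>f t\<bar> \<le> C"
    by (metis compact_imp_bounded bounded_iff image_eqI real_norm_def)
  have [measurable]: "f \<in> borel_measurable borel"
    using assms by (rule borel_measurable_continuous_onI)
  show ?thesis
  proof (rule Bochner_Integration.integrable_bound)
    show "integrable lborel (\<lambda>t. C * weight0 w t)"
      using weight0_integrable by simp
    show "AE t in lborel. norm (f t * weight0 w t) \<le> norm (C * weight0 w t)"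
    proof (rule AE_I2)
      fix t
      show "norm (f t * weight0 w t) \<le> norm (C * weight0 w t)"
      proof (cases "t \<in> {-1..1}")
        case True
        then have "\<bar>f t\<bar> \<le> \<bar>C\<bar>" using C[OF True] by linarith
        then show ?thesis by (simp add: abs_mult mult_right_mono)
      qed (simp add: weight0_outside)
    qed
  qed simp
qed

lemma poly_weight0_integrable: "integrable lborel (\<lambda>t. poly q t * weight0 w t)"
  by (intro continuous_weight0_integrable continuous_intros)

text \<open>A vanishing integral would force \<open>w = 0\<close> almost everywhere off the finite zero set of \<open>q\<close>.\<close>

lemma poly_weight0_integral_pos:
  assumes "q \<noteq> 0" "\<And>t. t \<in> {-1<..<1} \<Longrightarrow> 0 \<le> poly q t"
  shows "0 < (LINT t|lborel. poly q t * weight0 w t)"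
proof -
  have nonneg: "AE t in lborel. 0 \<le> poly q t * weight0 w t"
    using AE_lborel_singleton[of "-1"] AE_lborel_singleton[of 1]
  proof eventually_elim
    case (elim t)
    then show ?case
      using assms(2)[of t] weight0_nonneg[of t] weight0_outside[of t w]
      by (cases "t \<in> {-1..1}") auto
  qed
  have "(LINT t|lborel. poly q t * weight0 w t) \<noteq> 0"
  proof
    assume "(LINT t|lborel. poly q t * weight0 w t) = 0"
    then have "AE t in lborel. poly q t * weight0 w t = 0"
      using integral_nonneg_eq_0_iff_AE[OF poly_weight0_integrable nonneg] by simp
    moreover have "AE t in lborel. t \<notin> {t. poly q t = 0}"
      using poly_roots_finite[OF assms(1)]
      by (intro AE_not_in finite_imp_null_set_lborel)
    ultimately have "AE t in lborel. weight0 w t = 0"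
      by eventually_elim auto
    then have "(LINT t|lborel. weight0 w t) = 0"
      by (rule integral_eq_zero_AE)
    then show False using weight0_integral_pos by simp
  qed
  moreover have "0 \<le> (LINT t|lborel. poly q t * weight0 w t)"
    by (rule integral_nonneg_AE[OF nonneg])
  ultimately show ?thesis by simp
qed

end

text \<open>For \<open>Z\<close> take the zeros in \<open>(-1, 1)\<close> of odd order. The induction removes one
  linear factor at a time, which toggles membership of the corresponding zero in \<open>Z\<close>.\<close>

lemma sign_change_polynomial:
  fixes p :: "real poly"
  assumes "p \<noteq> 0"
  shows "\<exists>Z \<subseteq> {t. poly p t = 0}.
    (\<forall>t\<in>{-1<..<1}. 0 \<le> poly (p * (\<Prod>z\<in>Z. [:- z, 1:])) t) \<or>
    (\<forall>t\<in>{-1<..<1}. poly (p * (\<Prod>z\<in>Z. [:- z, 1:])) t \<le> 0)"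
  using assms
proof (induction "degree p" arbitrary: p rule: less_induct)
  case less
  show ?case
  proof (cases "\<exists>a\<in>{-1<..<1}. poly p a = 0")
    case False
    have "\<not> (0 < poly p s \<and> poly p t < 0)" if "s \<in> {-1<..<1}" "t \<in> {-1<..<1}" for s t
    proof
      assume st: "0 < poly p s \<and> poly p t < 0"
      then have "s \<noteq> t" by auto
      moreover from st that False have "\<not> s < t"
        using poly_IVT_neg[of s t p] by force
      moreover from st that False have "\<not> t < s"
        using poly_IVT_pos[of t s p] by force
      ultimately show False by linarith
    qed
    then have "(\<forall>t\<in>{-1<..<1}. 0 \<le> poly p t) \<or> (\<forall>t\<in>{-1<..<1}. poly p t \<le> 0)"
      using not_le by blast
    then show ?thesis
      by (intro exI[of _ "{}"]) simp
  next
    case True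
    then obtain a where a: "poly p a = 0" by blast
    then obtain r where r: "p = [:- a, 1:] * r"
      unfolding poly_eq_0_iff_dvd by (elim dvdE)
    then have "r \<noteq> 0" using less.prems by auto
    then have "degree p = Suc (degree r)"
      unfolding r by (subst degree_mult_eq) auto
    then obtain Z where Z: "Z \<subseteq> {t. poly r t = 0}" and
      sign: "(\<forall>t\<in>{-1<..<1}. 0 \<le> poly (r * (\<Prod>z\<in>Z. [:- z, 1:])) t) \<or>
        (\<forall>t\<in>{-1<..<1}. poly (r * (\<Prod>z\<in>Z. [:- z, 1:])) t \<le> 0)"
      using less.hyps[of r] \<open>r \<noteq> 0\<close> by auto
    have "finite Z" using poly_roots_finite[OF \<open>r \<noteq> 0\<close>] Z finite_subset by blast
    show ?thesis
    proof (cases "a \<in> Z")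
      case True
      have "p * (\<Prod>z\<in>Z - {a}. [:- z, 1:]) = r * (\<Prod>z\<in>Z. [:- z, 1:])"
        unfolding r prod.remove[OF \<open>finite Z\<close> True] by (simp only: mult_ac)
      moreover have "Z - {a} \<subseteq> {t. poly p t = 0}"
        using Z by (auto simp: r)
      ultimately show ?thesis
        using sign by (intro exI[of _ "Z - {a}"]) simp
    next
      case False
      have "p * (\<Prod>z\<in>insert a Z. [:- z, 1:]) = [:- a, 1:]\<^sup>2 * (r * (\<Prod>z\<in>Z. [:- z, 1:]))"
        unfolding r prod.insert[OF \<open>finite Z\<close> False] power2_eq_square by (simp only: mult_ac)
      then have eq: "poly (p * (\<Prod>z\<in>insert a Z. [:- z, 1:])) t =
          (t - a)\<^sup>2 * poly (r * (\<Prod>z\<in>Z. [:- z, 1:])) t" for t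
        by simp
      have "insert a Z \<subseteq> {t. poly p t = 0}"
        using Z a by (auto simp: r)
      moreover have "(\<forall>t\<in>{-1<..<1}. 0 \<le> poly (p * (\<Prod>z\<in>insert a Z. [:- z, 1:])) t) \<or>
          (\<forall>t\<in>{-1<..<1}. poly (p * (\<Prod>z\<in>insert a Z. [:- z, 1:])) t \<le> 0)"
        unfolding eq using sign by (meson mult_nonneg_nonneg mult_nonneg_nonpos zero_le_power2)
      ultimately show ?thesis by blast
    qed
  qed
qed

lemma orthogonal_poly_integral:
  assumes "orthogonal_poly w n p" "degree q < n"
  shows "(LINT t|lborel. poly p t * poly q t * weight0 w t) = 0"
  using assms unfolding orthogonal_poly_def set_lebesgue_integral_def
  by (auto simp: weight0_def mult_ac)

text \<open>If \<open>p\<close> changed sign fewer than \<open>n\<close> times, then it would be orthogonal to its sign-change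
  polynomial, although their product has constant sign.\<close>

lemma card_zeros_orthogonal_poly:
  assumes "weight_function w" "orthogonal_poly w n p"
  shows "card {t. poly p t = 0} = n"
proof -
  have "p \<noteq> 0" "degree p = n" using assms(2) by (auto simp: orthogonal_poly_def)
  obtain Z where Z: "Z \<subseteq> {t. poly p t = 0}" and
    sign: "(\<forall>t\<in>{-1<..<1}. 0 \<le> poly (p * (\<Prod>z\<in>Z. [:- z, 1:])) t) \<or>
      (\<forall>t\<in>{-1<..<1}. poly (p * (\<Prod>z\<in>Z. [:- z, 1:])) t \<le> 0)"
    using sign_change_polynomial[OF \<open>p \<noteq> 0\<close>] by blast
  have fin: "finite {t. poly p t = 0}" by (rule poly_roots_finite[OF \<open>p \<noteq> 0\<close>])
  define q where "q = (\<Prod>z\<in>Z. [:- z, 1:])"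
  have "degree q = card Z"
    unfolding q_def by (subst degree_prod_eq_sum_degree) auto
  have "q \<noteq> 0" unfolding q_def using finite_subset[OF Z fin] by (auto simp: prod_zero_iff)
  then have nz: "p * q \<noteq> 0" using \<open>p \<noteq> 0\<close> by simp
  have "\<not> card Z < n"
  proof
    assume "card Z < n"
    then have zero: "(LINT t|lborel. poly (p * q) t * weight0 w t) = 0"
      using orthogonal_poly_integral[OF assms(2), of q] \<open>degree q = card Z\<close> by simp
    show False
      using sign unfolding q_def[symmetric]
    proof
      assume "\<forall>t\<in>{-1<..<1}. 0 \<le> poly (p * q) t"
      then show False
        using poly_weight0_integral_pos[OF assms(1) nz] zero by simp
    next
      assume "\<forall>t\<in>{-1<..<1}. poly (p * q) t \<le> 0"
      then show False
        using poly_weight0_integral_pos[OF assms(1), of "- (p * q)"] nz zero by simp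
    qed
  qed
  moreover have "card Z \<le> card {t. poly p t = 0}" by (rule card_mono[OF fin Z])
  moreover have "card {t. poly p t = 0} \<le> n"
    using card_poly_roots_bound[OF \<open>p \<noteq> 0\<close>] \<open>degree p = n\<close> by simp
  ultimately show ?thesis by linarith
qed

section \<open>Lagrange interpolation and Gauss quadrature in one variable\<close>

locale orthogonal_zeros =
  fixes w :: "real \<Rightarrow> real" and n :: nat and p :: "real poly" and x :: "nat \<Rightarrow> real"
  assumes weight: "weight_function w"
    and pos: "0 < n"
    and orth: "orthogonal_poly w n p"
    and zeros: "x ` {1..n} = {t. poly p t = 0}"
begin

lemma p_nonzero: "p \<noteq> 0" and degree_p: "degree p = n"
  using orth by (auto simp: orthogonal_poly_def)

lemma card_nodes: "card (x ` {1..n}) = n"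
  unfolding zeros by (rule card_zeros_orthogonal_poly[OF weight orth])

lemma inj_nodes: "inj_on x {1..n}"
  by (rule eq_card_imp_inj_on) (use card_nodes in auto)

lemma node_zero: "k \<in> {1..n} \<Longrightarrow> poly p (x k) = 0"
  using zeros by blast

definition fund :: "nat \<Rightarrow> real poly" where
  "fund k = fund_poly p (x k)"

lemma fund_factorization:
  assumes "k \<in> {1..n}"
  obtains r where "p = [:- x k, 1:] * r" "poly r (x k) \<noteq> 0"
    "fund k = smult (1 / poly r (x k)) r" "degree r < n"
proof -
  obtain r where r: "p = [:- x k, 1:] * r"
    using node_zero[OF assms] unfolding poly_eq_0_iff_dvd by (elim dvdE)
  then have "r \<noteq> 0" using p_nonzero by auto
  then have "degree p = Suc (degree r)"
    unfolding r by (subst degree_mult_eq) auto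
  then have deg: "degree r < n" using degree_p by simp
  have "poly r (x k) \<noteq> 0"
  proof
    \<comment> \<open>otherwise \<open>r\<close> of degree \<open>n - 1\<close> would have all \<open>n\<close> zeros of \<open>p\<close>\<close>
    assume "poly r (x k) = 0"
    then have "{t. poly p t = 0} = {t. poly r t = 0}" by (auto simp: r)
    then show False
      using card_poly_roots_bound[OF \<open>r \<noteq> 0\<close>] deg card_nodes zeros by simp
  qed
  moreover have "fund k = smult (1 / poly r (x k)) r"
  proof -
    have "p div [:- x k, 1:] = r"
      by (subst r, rule nonzero_mult_div_cancel_left) simp
    moreover have "poly (pderiv p) (x k) = poly r (x k)"
      by (subst r) (simp add: pderiv_diff pderiv_smult pderiv_pCons)
    ultimately show ?thesis by (simp add: fund_def fund_poly_def)
  qed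
  ultimately show thesis using that r deg by blast
qed

lemma degree_fund: "k \<in> {1..n} \<Longrightarrow> degree (fund k) \<le> n - 1"
  by (rule fund_factorization[of k]) (auto simp: degree_smult_eq)

lemma fund_at_node:
  assumes "j \<in> {1..n}" "k \<in> {1..n}"
  shows "poly (fund k) (x j) = (if j = k then 1 else 0)"
proof -
  obtain r where r: "p = [:- x k, 1:] * r" "poly r (x k) \<noteq> 0"
    "fund k = smult (1 / poly r (x k)) r"
    using fund_factorization[OF assms(2)] by blast
  show ?thesis
  proof (cases "j = k")
    case False
    then have "x j \<noteq> x k" using inj_nodes assms by (auto dest: inj_onD)
    then have "poly r (x j) = 0" using node_zero[OF assms(1)] by (simp add: r(1))
    then show ?thesis using False by (simp add: r(3))
  qed (simp add: r(2,3))
qed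

lemma poly_eq_on_nodes:
  assumes "degree q < n" "degree r < n" "\<And>k. k \<in> {1..n} \<Longrightarrow> poly q (x k) = poly r (x k)"
  shows "q = r"
  by (rule poly_eqI_degree[of "x ` {1..n}"]) (use assms card_nodes in auto)

lemma lagrange_formula:
  assumes "degree q < n"
  shows "q = (\<Sum>k=1..n. smult (poly q (x k)) (fund k))"
proof (rule poly_eq_on_nodes[OF assms])
  have "degree (\<Sum>k=1..n. smult (poly q (x k)) (fund k)) \<le> n - 1"
    using degree_fund by (intro degree_sum_le) (auto intro: order_trans[OF degree_smult_le])
  then show "degree (\<Sum>k=1..n. smult (poly q (x k)) (fund k)) < n" using pos by simp
next
  fix k assume "k \<in> {1..n}"
  then have "poly (\<Sum>j=1..n. smult (poly q (x j)) (fund j)) (x k) =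
      (\<Sum>j=1..n. if k = j then poly q (x j) else 0)"
    unfolding poly_sum by (intro sum.cong) (auto simp: fund_at_node)
  then show "poly q (x k) = poly (\<Sum>j=1..n. smult (poly q (x j)) (fund j)) (x k)"
    using \<open>k \<in> {1..n}\<close> by simp
qed

definition christoffel :: "nat \<Rightarrow> real" where
  "christoffel k = (LINT t|lborel. poly (fund k) t * weight0 w t)"

text \<open>Dividing by \<open>p\<close> leaves a remainder that agrees with \<open>q\<close> at the nodes and a multiple of \<open>p\<close>
  whose integral vanishes by orthogonality.\<close>

lemma gauss_quadrature:
  assumes "degree q \<le> 2 * n - 1"
  shows "(LINT t|lborel. poly q t * weight0 w t) = (\<Sum>k=1..n. christoffel k * poly q (x k))"
proof -
  define d r where "d = q div p" and "r = q mod p"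
  have q: "q = p * d + r" unfolding d_def r_def by simp
  have r: "degree r < n"
    using degree_mod_less'[of p q] degree_p p_nonzero pos
    by (cases "r = 0") (auto simp: r_def)
  have d: "degree d < n"
  proof (rule ccontr)
    assume "\<not> degree d < n"
    then have "degree (p * d) \<ge> 2 * n" using p_nonzero pos degree_p by (subst degree_mult_eq) auto
    moreover from this r have "degree q = degree (p * d)"
      unfolding q by (intro degree_add_eq_left) linarith
    ultimately show False using assms pos by linarith
  qed
  have "(LINT t|lborel. poly q t * weight0 w t) =
      (LINT t|lborel. poly (p * d) t * weight0 w t + poly r t * weight0 w t)"
    by (subst q) (simp add: algebra_simps)
  also have "\<dots> = (LINT t|lborel. poly (p * d) t * weight0 w t) +
      (LINT t|lborel. poly r t * weight0 w t)"
    by (intro Bochner_Integration.integral_add poly_weight0_integrable weight)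
  also have "(LINT t|lborel. poly (p * d) t * weight0 w t) = 0"
    using orthogonal_poly_integral[OF orth d] by simp
  also have "(LINT t|lborel. poly r t * weight0 w t) =
      (LINT t|lborel. (\<Sum>k=1..n. poly r (x k) * (poly (fund k) t * weight0 w t)))"
    by (subst lagrange_formula[OF r]) (simp add: poly_sum sum_distrib_left mult_ac)
  also have "\<dots> = (\<Sum>k=1..n. poly r (x k) * christoffel k)"
    unfolding christoffel_def
    using poly_weight0_integrable[OF weight] by (subst Bochner_Integration.integral_sum) auto
  also have "\<dots> = (\<Sum>k=1..n. christoffel k * poly q (x k))"
    by (intro sum.cong) (auto simp: q node_zero)
  finally show ?thesis by simp
qed

text \<open>The quadrature rule is exact for the square of a fundamental polynomial, whose integral
  it evaluates to the corresponding weight.\<close>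

lemma christoffel_pos:
  assumes "k \<in> {1..n}"
  shows "0 < christoffel k"
proof -
  have "degree ((fund k)\<^sup>2) \<le> 2 * n - 1"
    using degree_fund[OF assms] degree_power_le[of "fund k" 2] by simp
  then have "(LINT t|lborel. poly ((fund k)\<^sup>2) t * weight0 w t) =
      (\<Sum>j=1..n. christoffel j * poly ((fund k)\<^sup>2) (x j))"
    by (rule gauss_quadrature)
  also have "\<dots> = (\<Sum>j=1..n. if j = k then christoffel j else 0)"
    using assms by (intro sum.cong) (auto simp: fund_at_node)
  finally have "(LINT t|lborel. poly ((fund k)\<^sup>2) t * weight0 w t) = christoffel k"
    using assms by simp
  moreover have "fund k \<noteq> 0" using fund_at_node[OF assms assms] by auto
  ultimately show ?thesis
    using poly_weight0_integral_pos[OF weight, of "(fund k)\<^sup>2"] by simp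
qed

end

section \<open>The change of variables \<open>u = x + y\<close>, \<open>v = x y\<close>\<close>

definition sum_prod :: "real \<times> real \<Rightarrow> real \<times> real" where
  "sum_prod z = (fst z + snd z, fst z * snd z)"

lemma sum_prod_measurable [measurable]: "sum_prod \<in> borel \<rightarrow>\<^sub>M borel"
  unfolding sum_prod_def[abs_def]
  by (intro borel_measurable_continuous_onI continuous_intros)

text \<open>The pullback to the \<open>(x, y)\<close>-plane of the unnormalized weight: the factor \<open>\<bar>x - y\<bar>\<close> is the
  Jacobian, and the factor \<open>1 / 2\<close> accounts for the two preimages \<open>(x, y)\<close> and \<open>(y, x)\<close>.\<close>

definition pullback_weight :: "(real \<Rightarrow> real) \<Rightarrow> real \<Rightarrow> real \<times> real \<Rightarrow> real" where
  "pullback_weight w g z =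
     weight0 w (fst z) * weight0 w (snd z) * (((fst z - snd z)\<^sup>2 powr g) * \<bar>fst z - snd z\<bar>) / 2"

lemma W_unnormalized_eq:
  "W_unnormalized w g (u, v) = indicator Omega (u, v) *
     (weight0 w ((u - sqrt (u\<^sup>2 - 4 * v)) / 2) * weight0 w ((u + sqrt (u\<^sup>2 - 4 * v)) / 2) *
      (u\<^sup>2 - 4 * v) powr g)"
  by (simp add: W_unnormalized_def Let_def weight0_def)

lemma Omega_sets [measurable]: "Omega \<in> sets borel"
proof -
  have "Omega = {z. 0 < 1 + fst z + snd z} \<inter> {z. 0 < 1 - fst z + snd z} \<inter> {z. 4 * snd z < (fst z)\<^sup>2}"
    by (auto simp: Omega_def)
  also have "open \<dots>"
    by (intro open_Int open_Collect_less continuous_intros)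
  finally show ?thesis by (rule borel_open)
qed

lemma nn_integral_even:
  fixes f :: "real \<Rightarrow> ennreal"
  assumes [measurable]: "f \<in> borel_measurable borel" and even: "\<And>r. f (- r) = f r"
  shows "(\<integral>\<^sup>+r. f r \<partial>lborel) = 2 * (\<integral>\<^sup>+r. f r * indicator {0..} r \<partial>lborel)"
proof -
  have "(\<integral>\<^sup>+r. f r * indicator {..<0} r \<partial>lborel) = (\<integral>\<^sup>+r. f r * indicator {0<..} r \<partial>lborel)"
    by (subst nn_integral_real_affine[where c = "-1" and t = 0])
      (auto simp: even indicator_def intro!: nn_integral_cong)
  also have "\<dots> = (\<integral>\<^sup>+r. f r * indicator {0..} r \<partial>lborel)"
    by (intro nn_integral_cong_AE eventually_mono[OF AE_lborel_singleton[of 0]])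
      (auto simp: indicator_def)
  finally have neg: "(\<integral>\<^sup>+r. f r * indicator {..<0} r \<partial>lborel) =
    (\<integral>\<^sup>+r. f r * indicator {0..} r \<partial>lborel)" .
  have "(\<integral>\<^sup>+r. f r \<partial>lborel) =
      (\<integral>\<^sup>+r. f r * indicator {..<0} r + f r * indicator {0..} r \<partial>lborel)"
    by (intro nn_integral_cong) (auto simp: indicator_def)
  also have "\<dots> = (\<integral>\<^sup>+r. f r * indicator {..<0} r \<partial>lborel) + (\<integral>\<^sup>+r. f r * indicator {0..} r \<partial>lborel)"
    by (intro nn_integral_add) auto
  finally show ?thesis unfolding neg by (simp add: mult_2)
qed

context
  fixes w :: "real \<Rightarrow> real"
  assumes w: "weight_function w"
begin

lemma W_unnormalized_measurable [measurable]: "W_unnormalized w g \<in> borel_measurable borel"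
proof -
  note [measurable] = weight0_measurable[OF w]
  have "W_unnormalized w g = (\<lambda>z. indicator Omega z *
     (weight0 w ((fst z - sqrt ((fst z)\<^sup>2 - 4 * snd z)) / 2) *
      weight0 w ((fst z + sqrt ((fst z)\<^sup>2 - 4 * snd z)) / 2) *
      ((fst z)\<^sup>2 - 4 * snd z) powr g))"
    by (intro ext, case_tac z) (simp add: W_unnormalized_eq)
  also have "\<dots> \<in> borel_measurable (borel \<Otimes>\<^sub>M borel)"
    using Omega_sets unfolding borel_prod[symmetric] by measurable
  finally show ?thesis unfolding borel_prod .
qed

lemma W_unnormalized_nonneg: "0 \<le> W_unnormalized w g z"
  using weight0_nonneg[OF w] by (cases z) (simp add: W_unnormalized_eq)

lemma pullback_weight_measurable [measurable]: "pullback_weight w g \<in> borel_measurable borel"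
proof -
  note [measurable] = weight0_measurable[OF w]
  have "pullback_weight w g \<in> borel_measurable (borel \<Otimes>\<^sub>M borel)"
    unfolding pullback_weight_def[abs_def] by measurable
  then show ?thesis unfolding borel_prod .
qed

lemma pullback_weight_nonneg: "0 \<le> pullback_weight w g z"
  using weight0_nonneg[OF w] by (simp add: pullback_weight_def)

text \<open>For fixed \<open>u\<close> substitute \<open>v = (u\<^sup>2 - r\<^sup>2) / 4\<close>, where \<open>r = y - x\<close>. The integrand vanishes for
  \<open>r > 2\<close> because one of \<open>x\<close>, \<open>y\<close> then lies outside \<open>[-1, 1]\<close>, so that a substitution on
  \<open>[0, 2]\<close> is enough. By symmetry in \<open>r\<close> the integral extends to all \<open>r\<close>, and \<open>r = 2 y - u\<close> brings
  back the variable \<open>y\<close>.\<close>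

lemma nn_integral_substitute_product:
  fixes A :: "(real \<times> real) set"
  assumes A [measurable]: "A \<in> sets borel"
  shows "(\<integral>\<^sup>+v. ennreal (indicator A (u, v) * W_unnormalized w g (u, v)) \<partial>lborel) =
    (\<integral>\<^sup>+y. ennreal (indicator (A \<inter> Omega) (sum_prod (u - y, y)) * pullback_weight w g (u - y, y))
      \<partial>lborel)"
proof -
  note [measurable] = weight0_measurable[OF w]
  define H where "H v = indicator A (u, v) * W_unnormalized w g (u, v)" for v
  have "(\<lambda>v. (u, v)) \<in> borel \<rightarrow>\<^sub>M borel"
    by (intro borel_measurable_continuous_onI continuous_intros)
  then have H_meas [measurable]: "H \<in> borel_measurable borel"
    unfolding H_def[abs_def] by measurable
  define F where "F r = indicator (A \<inter> Omega) (sum_prod ((u - r) / 2, (u + r) / 2)) *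
    pullback_weight w g ((u - r) / 2, (u + r) / 2)" for r
  have "(\<lambda>r. ((u - r) / 2, (u + r) / 2)) \<in> borel \<rightarrow>\<^sub>M borel"
    by (intro borel_measurable_continuous_onI continuous_intros) auto
  then have F_meas [measurable]: "F \<in> borel_measurable borel"
    unfolding F_def[abs_def] by measurable
  have F_even: "F (- r) = F r" for r
    by (simp add: F_def pullback_weight_def sum_prod_def mult_ac power2_commute abs_minus_commute
        add.commute)
  have F_large: "F r = 0" if "2 < r" for r
  proof -
    have "(u - r) / 2 \<notin> {-1..1} \<or> (u + r) / 2 \<notin> {-1..1}"
      using that by auto
    then show ?thesis
      using weight0_outside[of _ w] by (auto simp: F_def pullback_weight_def)
  qed
  have HF: "H ((u\<^sup>2 - r\<^sup>2) / 4) * (r / 2) = F r" if "0 \<le> r" for r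
  proof -
    have sp: "sum_prod ((u - r) / 2, (u + r) / 2) = (u, (u\<^sup>2 - r\<^sup>2) / 4)"
      by (simp add: sum_prod_def field_simps power2_eq_square)
    have "((u - r) / 2 - (u + r) / 2) = - r" by (simp add: field_simps)
    moreover have "u\<^sup>2 - 4 * ((u\<^sup>2 - r\<^sup>2) / 4) = r\<^sup>2" by (simp add: field_simps)
    ultimately show ?thesis
      using that unfolding H_def F_def sp W_unnormalized_eq pullback_weight_def fst_conv snd_conv
      by (simp add: indicator_def)
  qed
  have H_support: "H (- v) = H (- v) * indicator {(0\<^sup>2 - u\<^sup>2) / 4..(2\<^sup>2 - u\<^sup>2) / 4} v" for v
  proof (cases "v \<in> {(0\<^sup>2 - u\<^sup>2) / 4..(2\<^sup>2 - u\<^sup>2) / 4}")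
    case False
    have "H (- v) = 0"
    proof (cases "v < (0\<^sup>2 - u\<^sup>2) / 4")
      case True
      then have "(u, - v) \<notin> Omega" by (auto simp: Omega_def)
      then show ?thesis by (simp add: H_def W_unnormalized_eq)
    next
      case False
      then have d: "4 < u\<^sup>2 - 4 * (- v)"
        using \<open>v \<notin> _\<close> by auto
      define r where "r = sqrt (u\<^sup>2 - 4 * (- v))"
      have "2 < r" using real_sqrt_less_mono[OF d] by (simp add: r_def)
      then have "H ((u\<^sup>2 - r\<^sup>2) / 4) = 0" using HF[of r] F_large[of r] by simp
      moreover have "(u\<^sup>2 - r\<^sup>2) / 4 = - v" using d by (simp add: r_def)
      ultimately show ?thesis by (simp only:)
    qed
    then show ?thesis by simp
  qed simp
  have "(\<integral>\<^sup>+v. ennreal (H v) \<partial>lborel) = (\<integral>\<^sup>+v. ennreal (H (- v)) \<partial>lborel)"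
    by (subst nn_integral_real_affine[where c = "-1" and t = 0]) auto
  also have "\<dots> = (\<integral>\<^sup>+v. ennreal (H (- v) * indicator {(0\<^sup>2 - u\<^sup>2) / 4..(2\<^sup>2 - u\<^sup>2) / 4} v) \<partial>lborel)"
    by (intro nn_integral_cong arg_cong[OF H_support])
  also have "\<dots> = (\<integral>\<^sup>+r. ennreal (H (- ((r\<^sup>2 - u\<^sup>2) / 4)) * (r / 2) * indicator {0..2} r) \<partial>lborel)"
    by (rule nn_integral_substitution)
      (auto simp: set_borel_measurable_def intro!: derivative_eq_intros continuous_intros)
  also have "\<dots> = (\<integral>\<^sup>+r. ennreal (F r) * indicator {0..} r \<partial>lborel)"
  proof (intro nn_integral_cong)
    fix r :: real
    have "- ((r\<^sup>2 - u\<^sup>2) / 4) = (u\<^sup>2 - r\<^sup>2) / 4"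
      by (metis minus_diff_eq minus_divide_left)
    then show "ennreal (H (- ((r\<^sup>2 - u\<^sup>2) / 4)) * (r / 2) * indicator {0..2} r) =
        ennreal (F r) * indicator {0..} r"
      using HF[of r] F_large[of r] by (simp only:) (auto simp: indicator_def)
  qed
  finally have "2 * (\<integral>\<^sup>+v. ennreal (H v) \<partial>lborel) = (\<integral>\<^sup>+r. ennreal (F r) \<partial>lborel)"
    using nn_integral_even[of "\<lambda>r. ennreal (F r)"] F_even by simp
  also have "\<dots> = 2 * (\<integral>\<^sup>+y. ennreal (F (- u + 2 * y)) \<partial>lborel)"
    by (subst nn_integral_real_affine[where c = 2 and t = "- u"]) auto
  finally have "(\<integral>\<^sup>+v. ennreal (H v) \<partial>lborel) = (\<integral>\<^sup>+y. ennreal (F (- u + 2 * y)) \<partial>lborel)"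
    by (simp add: ennreal_mult_cancel_left)
  moreover have "F (- u + 2 * y) =
      indicator (A \<inter> Omega) (sum_prod (u - y, y)) * pullback_weight w g (u - y, y)" for y
  proof -
    have "(u - (- u + 2 * y)) / 2 = u - y" "(u + (- u + 2 * y)) / 2 = y"
      by (simp_all add: field_simps)
    then show ?thesis by (simp only: F_def)
  qed
  ultimately show ?thesis by (simp only: H_def)
qed

text \<open>An equality of measures, unlike one of integrals of nonnegative functions, transfers at once
  to the integrals of polynomials of varying sign.\<close>

lemma density_W_unnormalized:
  "density lborel (\<lambda>z. ennreal (W_unnormalized w g z)) =
   distr (density lborel (\<lambda>z. ennreal (pullback_weight w g z))) borel sum_prod"
proof (rule measure_eqI)
  fix A :: "(real \<times> real) set"
  assume "A \<in> sets (density lborel (\<lambda>z. ennreal (W_unnormalized w g z)))"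
  then have A [measurable]: "A \<in> sets borel" by simp
  define K where "K z = indicator (A \<inter> Omega) (sum_prod z) * pullback_weight w g z" for z
  have K_meas: "K \<in> borel_measurable (borel \<Otimes>\<^sub>M borel)"
    unfolding borel_prod K_def[abs_def] by measurable
  note [measurable] = K_meas
  define H where "H z = indicator A z * W_unnormalized w g z" for z
  have [measurable]: "H \<in> borel_measurable (borel \<Otimes>\<^sub>M borel)"
    unfolding borel_prod H_def[abs_def] by measurable
  define K' where "K' z = indicator A (sum_prod z) * pullback_weight w g z" for z
  have [measurable]: "K' \<in> borel_measurable (borel \<Otimes>\<^sub>M borel)"
    unfolding borel_prod K'_def[abs_def] by measurable
  have "emeasure (density lborel (\<lambda>z. ennreal (W_unnormalized w g z))) A =
      (\<integral>\<^sup>+z. ennreal (H z) \<partial>lborel)"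
    by (subst emeasure_density) (auto simp: H_def indicator_def intro!: nn_integral_cong)
  also have "\<dots> = (\<integral>\<^sup>+u. (\<integral>\<^sup>+v. ennreal (H (u, v)) \<partial>lborel) \<partial>lborel)"
    unfolding lborel_prod[symmetric] by (subst lborel.nn_integral_fst) auto
  also have "\<dots> = (\<integral>\<^sup>+u. (\<integral>\<^sup>+y. ennreal (K (u - y, y)) \<partial>lborel) \<partial>lborel)"
    unfolding H_def K_def using nn_integral_substitute_product[OF A] by simp
  also have "\<dots> = (\<integral>\<^sup>+y. (\<integral>\<^sup>+u. ennreal (K (u - y, y)) \<partial>lborel) \<partial>lborel)"
    by (rule lborel_pair.Fubini'[symmetric]) measurable
  also have "\<dots> = (\<integral>\<^sup>+y. (\<integral>\<^sup>+x. ennreal (K (x, y)) \<partial>lborel) \<partial>lborel)"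
  proof (rule nn_integral_cong)
    fix y :: real
    show "(\<integral>\<^sup>+u. ennreal (K (u - y, y)) \<partial>lborel) = (\<integral>\<^sup>+x. ennreal (K (x, y)) \<partial>lborel)"
      using nn_integral_real_affine[where f = "\<lambda>u. ennreal (K (u - y, y))" and c = 1 and t = y]
      by simp
  qed
  also have "\<dots> = (\<integral>\<^sup>+y. (\<integral>\<^sup>+x. ennreal (K' (x, y)) \<partial>lborel) \<partial>lborel)"
  proof (rule nn_integral_cong_AE, use AE_lborel_singleton[of "-1"] AE_lborel_singleton[of 1] in eventually_elim)
    \<comment> \<open>A point \<open>(x, y)\<close> of the square \<open>[-1, 1]\<^sup>2\<close> is mapped into \<open>Omega\<close> unless \<open>x = y\<close> or one of
      the coordinates is \<open>1\<close> or \<open>-1\<close>.\<close>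
    fix y :: real assume y: "y \<noteq> -1" "y \<noteq> 1"
    show "(\<integral>\<^sup>+x. ennreal (K (x, y)) \<partial>lborel) = (\<integral>\<^sup>+x. ennreal (K' (x, y)) \<partial>lborel)"
    proof (rule nn_integral_cong_AE,
        use AE_lborel_singleton[of "-1"] AE_lborel_singleton[of 1] AE_lborel_singleton[of y]
        in eventually_elim)
      fix x :: real assume x: "x \<noteq> -1" "x \<noteq> 1" "x \<noteq> y"
      show "ennreal (K (x, y)) = ennreal (K' (x, y))"
      proof (cases "x \<in> {-1..1} \<and> y \<in> {-1..1}")
        case True
        then have "0 < (1 + x) * (1 + y)" "0 < (1 - x) * (1 - y)" "0 < (x - y)\<^sup>2"
          using x y by auto
        then have "sum_prod (x, y) \<in> Omega"
          by (simp add: Omega_def sum_prod_def algebra_simps power2_eq_square)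
        then show ?thesis by (simp add: K_def K'_def indicator_def)
      next
        case False
        then show ?thesis
          using weight0_outside[of _ w] by (auto simp: K_def K'_def pullback_weight_def)
      qed
    qed
  qed
  also have "\<dots> = (\<integral>\<^sup>+z. ennreal (K' z) \<partial>lborel)"
    unfolding lborel_prod[symmetric] by (subst lborel_pair.nn_integral_snd) auto
  also have "\<dots> = emeasure (distr (density lborel (\<lambda>z. ennreal (pullback_weight w g z))) borel sum_prod) A"
    using measurable_sets_borel[OF sum_prod_measurable A]
    by (subst emeasure_distr, simp, simp, subst emeasure_density)
      (auto simp: K'_def indicator_def intro!: nn_integral_cong)
  finally show "emeasure (density lborel (\<lambda>z. ennreal (W_unnormalized w g z))) A =
    emeasure (distr (density lborel (\<lambda>z. ennreal (pullback_weight w g z))) borel sum_prod) A" .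
qed simp

lemma has_bochner_integral_W_unnormalized:
  assumes [measurable]: "P \<in> borel_measurable borel"
    and "has_bochner_integral lborel (\<lambda>z. P (sum_prod z) * pullback_weight w g z) I"
  shows "has_bochner_integral lborel (\<lambda>z. P z * W_unnormalized w g z) I"
proof -
  let ?D = "density lborel (\<lambda>z. ennreal (W_unnormalized w g z))"
  have "has_bochner_integral (density lborel (\<lambda>z. ennreal (pullback_weight w g z)))
      (\<lambda>z. P (sum_prod z)) I"
    using assms(2) by (intro has_bochner_integral_density) (auto simp: pullback_weight_nonneg mult_ac)
  then have "has_bochner_integral ?D P I"
    unfolding density_W_unnormalized by (intro has_bochner_integral_distr) auto
  then show ?thesis
    by (simp add: has_bochner_integral_iff integrable_density integral_density
        W_unnormalized_nonneg mult.commute)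
qed

end

section \<open>The Gaussian cubature rules\<close>

context orthogonal_zeros
begin

lemma product_weight_integrable:
  "integrable lborel (\<lambda>z. weight0 w (fst z) * weight0 w (snd z))"
proof -
  note [measurable] = weight0_measurable[OF weight]
  have "integrable (lborel \<Otimes>\<^sub>M lborel) (\<lambda>z. weight0 w (fst z) * weight0 w (snd z))"
  proof (rule lborel_pair.Fubini_integrable)
    show "integrable lborel (\<lambda>s. LINT t|lborel. norm (weight0 w (fst (s, t)) * weight0 w (snd (s, t))))"
      using weight0_integrable[OF weight] weight0_nonneg[OF weight] by (simp add: abs_mult)
    show "AE s in lborel. integrable lborel (\<lambda>t. weight0 w (fst (s, t)) * weight0 w (snd (s, t)))"
      using weight0_integrable[OF weight] by simp
  qed measurable
  then show ?thesis unfolding lborel_prod .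
qed

lemma continuous_product_weight_integrable:
  fixes Q :: "real \<times> real \<Rightarrow> real"
  assumes "continuous_on UNIV Q"
  shows "integrable lborel (\<lambda>z. Q z * (weight0 w (fst z) * weight0 w (snd z)))"
proof -
  have "compact (Q ` ({-1..1} \<times> {-1..1}))"
    by (intro compact_continuous_image continuous_on_subset[OF assms] compact_Times) auto
  then obtain C where C: "\<And>z. z \<in> {-1..1} \<times> {-1..1} \<Longrightarrow> \<bar>Q z\<bar> \<le> C"
    by (metis compact_imp_bounded bounded_iff image_eqI real_norm_def)
  have [measurable]: "Q \<in> borel_measurable borel"
    using assms by (rule borel_measurable_continuous_onI)
  have [measurable]: "(\<lambda>z. weight0 w (fst z) * weight0 w (snd z)) \<in> borel_measurable borel"
    using borel_measurable_integrable[OF product_weight_integrable] by simp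
  show ?thesis
  proof (rule Bochner_Integration.integrable_bound)
    show "integrable lborel (\<lambda>z. C * (weight0 w (fst z) * weight0 w (snd z)))"
      using product_weight_integrable by simp
    show "AE z in lborel. norm (Q z * (weight0 w (fst z) * weight0 w (snd z))) \<le>
        norm (C * (weight0 w (fst z) * weight0 w (snd z)))"
    proof (rule AE_I2)
      fix z :: "real \<times> real"
      show "norm (Q z * (weight0 w (fst z) * weight0 w (snd z))) \<le>
        norm (C * (weight0 w (fst z) * weight0 w (snd z)))"
      proof (cases "z \<in> {-1..1} \<times> {-1..1}")
        case True
        then have "\<bar>Q z\<bar> \<le> \<bar>C\<bar>" using C[OF True] by linarith
        then show ?thesis by (simp add: abs_mult mult_right_mono)
      next
        case False
        then show ?thesis
          using weight0_outside[of "fst z" w] weight0_outside[of "snd z" w] by (auto simp: mem_Times_iff)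
      qed
    qed
  qed measurable
qed

text \<open>Apply the quadrature rule first in the second variable and then in the first one.\<close>

lemma product_quadrature:
  fixes Q :: "real \<times> real \<Rightarrow> real"
  assumes cont: "continuous_on UNIV Q"
    and slice1: "\<And>t. \<exists>q. degree q \<le> 2 * n - 1 \<and> (\<forall>s. poly q s = Q (s, t))"
    and slice2: "\<And>s. \<exists>q. degree q \<le> 2 * n - 1 \<and> (\<forall>t. poly q t = Q (s, t))"
  shows "has_bochner_integral lborel (\<lambda>z. Q z * (weight0 w (fst z) * weight0 w (snd z)))
    (\<Sum>(j, k)\<in>{1..n} \<times> {1..n}. christoffel j * christoffel k * Q (x j, x k))"
proof -
  let ?f = "\<lambda>z. Q z * (weight0 w (fst z) * weight0 w (snd z))"
  have quad1: "integrable lborel (\<lambda>s. Q (s, t) * weight0 w s) \<and>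
      (LINT s|lborel. Q (s, t) * weight0 w s) = (\<Sum>j=1..n. christoffel j * Q (x j, t))" for t
  proof -
    obtain q where "degree q \<le> 2 * n - 1" "\<And>s. poly q s = Q (s, t)" using slice1 by blast
    with gauss_quadrature[of q] poly_weight0_integrable[OF weight, of q] show ?thesis by simp
  qed
  have quad2: "(LINT t|lborel. Q (s, t) * weight0 w t) = (\<Sum>k=1..n. christoffel k * Q (s, x k))" for s
  proof -
    obtain q where "degree q \<le> 2 * n - 1" "\<And>t. poly q t = Q (s, t)" using slice2 by blast
    with gauss_quadrature[of q] show ?thesis by simp
  qed
  have int: "integrable (lborel \<Otimes>\<^sub>M lborel) ?f"
    unfolding lborel_prod by (rule continuous_product_weight_integrable[OF cont])
  have "(LINT z|lborel. ?f z) = (LINT s|lborel. LINT t|lborel. ?f (s, t))"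
    using lborel_pair.integral_fst'[OF int] unfolding lborel_prod by simp
  also have "\<dots> = (LINT s|lborel. weight0 w s * (LINT t|lborel. Q (s, t) * weight0 w t))"
    by (subst integral_mult_right_zero[symmetric]) (simp add: mult_ac)
  also have "\<dots> = (LINT s|lborel. (\<Sum>k=1..n. christoffel k * (Q (s, x k) * weight0 w s)))"
    unfolding quad2 by (simp add: sum_distrib_left mult_ac)
  also have "\<dots> = (\<Sum>k=1..n. christoffel k * (\<Sum>j=1..n. christoffel j * Q (x j, x k)))"
    using quad1 by (subst Bochner_Integration.integral_sum) auto
  also have "\<dots> = (\<Sum>j=1..n. \<Sum>k=1..n. christoffel j * christoffel k * Q (x j, x k))"
    by (subst sum.swap) (simp add: sum_distrib_left mult_ac)
  finally show ?thesis
    using int unfolding lborel_prod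
    by (simp add: has_bochner_integral_iff sum.cartesian_product)
qed

lemma AE_off_diagonal: "AE z in lborel. fst z \<noteq> (snd z :: real)"
proof -
  have "AE z in lborel \<Otimes>\<^sub>M lborel. fst z \<noteq> (snd z :: real)"
  proof (rule lborel_pair.AE_pair_measure)
    have "{z \<in> space (lborel \<Otimes>\<^sub>M lborel). fst z \<noteq> (snd z :: real)} = {z. fst z \<noteq> snd z}"
      by (simp add: space_pair_measure)
    also have "open {z. fst z \<noteq> (snd z :: real)}"
      by (intro open_Collect_neq continuous_intros)
    then have "{z. fst z \<noteq> (snd z :: real)} \<in> sets (lborel \<Otimes>\<^sub>M lborel)"
      unfolding lborel_prod by (simp add: borel_open)
    finally show "{z \<in> space (lborel \<Otimes>\<^sub>M lborel). fst z \<noteq> (snd z :: real)}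
        \<in> sets (lborel \<Otimes>\<^sub>M lborel)" .
    show "AE s in lborel. AE t in lborel. fst (s, t) \<noteq> (snd (s, t) :: real)"
    proof (rule AE_I2)
      fix s :: real
      show "AE t in lborel. fst (s, t) \<noteq> snd (s, t)"
        using AE_lborel_singleton[of s] by eventually_elim auto
    qed
  qed
  then show ?thesis unfolding lborel_prod .
qed

lemma Pi2_sum_prod_slices:
  assumes "P \<in> Pi2 m"
  obtains q where "int (degree q) \<le> m \<or> q = 0" "\<And>s. poly q s = P (sum_prod (s, t))"
    "\<And>s. poly q s = P (sum_prod (t, s))"
  using Pi2_slice[OF assms, of t] by (auto simp: sum_prod_def add.commute mult.commute)

text \<open>Each pair in \<open>I\<close> contributes a positive amount to the coefficient of its node, so that merging
  pairs with the same node causes no cancellation. If there are nodes at all, then taking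
  \<open>P = 1\<close> shows that the normalization constant is positive.\<close>

lemma cubature_rule_from_product:
  assumes fin: "finite I" and pos_b: "\<And>j k. (j, k) \<in> I \<Longrightarrow> 0 < b j k"
    and S: "S = (\<lambda>(j, k). node x j k) ` I"
    and d: "I \<noteq> {} \<Longrightarrow> 0 \<le> d"
    and int: "\<And>P. P \<in> Pi2 d \<Longrightarrow> has_bochner_integral lborel (\<lambda>z. P z * W_unnormalized w g z)
      (\<Sum>(j, k)\<in>I. b j k * P (node x j k))"
  shows "\<exists>a. cubature_rule (W w g) d S a"
proof -
  define Z where "Z = (LINT z|lborel. W_unnormalized w g z)"
  define B where "B s = (\<Sum>(j, k)\<in>{i \<in> I. (\<lambda>(j, k). node x j k) i = s}. b j k)" for s
  have B_pos: "0 < B s" if "s \<in> S" for s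
    unfolding B_def using that fin pos_b unfolding S
    by (intro sum_pos) auto
  have "Z \<noteq> 0" if "I \<noteq> {}"
  proof -
    have "(\<lambda>_. 1) \<in> Pi2 d"
      using Pi2_monomial[of 0 0 d] d[OF that] by simp
    from int[OF this] have "Z = (\<Sum>(j, k)\<in>I. b j k)"
      unfolding Z_def by (simp add: has_bochner_integral_integral_eq)
    also have "\<dots> > 0"
      using pos_b fin that by (intro sum_pos) auto
    finally show ?thesis by simp
  qed
  moreover have "finite S" using fin by (simp add: S)
  moreover have "has_bochner_integral lborel (\<lambda>z. P z * W w g z) (\<Sum>s\<in>S. B s / Z * P s)"
    if "P \<in> Pi2 d" for P
  proof -
    have "(\<Sum>(j, k)\<in>I. b j k * P (node x j k)) =
        (\<Sum>s\<in>S. \<Sum>(j, k)\<in>{i \<in> I. (\<lambda>(j, k). node x j k) i = s}. b j k * P (node x j k))"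
      using fin \<open>finite S\<close> by (subst sum.group) (auto simp: S)
    also have "\<dots> = (\<Sum>s\<in>S. B s * P s)"
      unfolding B_def sum_distrib_right by (intro sum.cong) auto
    finally show ?thesis
      using has_bochner_integral_divide_zero[OF int[OF that], of Z]
      by (simp add: W_def Z_def sum_divide_distrib)
  qed
  ultimately show ?thesis
    using B_pos S unfolding cubature_rule_def
    by (intro exI[of _ "\<lambda>s. B s / Z"]) (auto simp: less_imp_neq[THEN not_sym])
qed

lemma node_eq_iff:
  assumes "j \<in> {1..n}" "k \<in> {1..n}" "j' \<in> {1..n}" "k' \<in> {1..n}"
  shows "node x j k = node x j' k' \<longleftrightarrow> (j = j' \<and> k = k') \<or> (j = k' \<and> k = j')"
proof
  assume "node x j k = node x j' k'"
  then have eq: "x j + x k = x j' + x k'" "x j * x k = x j' * x k'"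
    by (auto simp: node_def)
  \<comment> \<open>\<open>x j\<close> is a zero of the quadratic polynomial with zeros \<open>x j'\<close> and \<open>x k'\<close>\<close>
  have "(x j - x j') * (x j - x k') = x j * (x j - (x j' + x k')) + x j' * x k'"
    by (simp add: algebra_simps)
  also have "\<dots> = 0" unfolding eq[symmetric] by (simp add: algebra_simps)
  finally have "x j = x j' \<and> x k = x k' \<or> x j = x k' \<and> x k = x j'" using eq(1) by auto
  then show "(j = j' \<and> k = k') \<or> (j = k' \<and> k = j')"
    using assms by (metis inj_nodes inj_onD)
qed (auto simp: node_def)

text \<open>Up to a null set, the pullback of \<open>W\<^bsub>-1/2\<^esub>\<close> is half the product weight, because the
  Jacobian cancels the factor \<open>(u\<^sup>2 - 4 v)\<^bsup>-1/2\<^esup>\<close>.\<close>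

lemma gaussian_nodes_minus:
  "gaussian_nodes (W w (- 1 / 2)) n {node x j k | j k. 1 \<le> j \<and> j \<le> k \<and> k \<le> n}"
  (is "gaussian_nodes _ _ ?S")
proof -
  have "?S = (\<lambda>(k, j). node x j k) ` (SIGMA k:{1..n}. {1..k})"
    by force
  moreover have "inj_on (\<lambda>(k, j). node x j k) (SIGMA k:{1..n}. {1..k})"
    by (rule inj_onI) (auto simp: node_eq_iff)
  ultimately have "card ?S = (\<Sum>k=1..n. k)"
    by (simp add: card_image card_SigmaI)
  also have "\<dots> = n * (n + 1) div 2"
    by (induction n) auto
  finally have card: "card ?S = n * (n + 1) div 2" .
  have S: "?S = (\<lambda>(j, k). node x j k) ` ({1..n} \<times> {1..n})"
  proof (intro equalityI subsetI)
    fix s assume "s \<in> (\<lambda>(j, k). node x j k) ` ({1..n} \<times> {1..n})"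
    then obtain j k where jk: "s = node x j k" "j \<in> {1..n}" "k \<in> {1..n}" by auto
    moreover have "node x j k = node x k j" by (simp add: node_def)
    ultimately show "s \<in> ?S"
      by (cases "j \<le> k") (force intro: exI[of _ j] exI[of _ k])+
  qed force
  have "\<exists>a. cubature_rule (W w (- 1 / 2)) (2 * int n - 1) ?S a"
  proof (rule cubature_rule_from_product[where b = "\<lambda>j k. christoffel j * christoffel k / 2", OF _ _ S])
    fix P assume P: "P \<in> Pi2 (2 * int n - 1)"
    have cont: "continuous_on UNIV (\<lambda>z. P (sum_prod z) / 2)"
      unfolding sum_prod_def
      by (intro continuous_intros continuous_on_compose2[OF continuous_Pi2[OF P]]) auto
    have "has_bochner_integral lborel
        (\<lambda>z. P (sum_prod z) / 2 * (weight0 w (fst z) * weight0 w (snd z)))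
        (\<Sum>(j, k)\<in>{1..n} \<times> {1..n}. christoffel j * christoffel k * (P (sum_prod (x j, x k)) / 2))"
    proof (rule product_quadrature[OF cont])
      fix t
      obtain q where q: "int (degree q) \<le> 2 * int n - 1 \<or> q = 0"
        "\<And>s. poly q s = P (sum_prod (s, t))" "\<And>s. poly q s = P (sum_prod (t, s))"
        using Pi2_sum_prod_slices[OF P, of t] by blast
      have deg: "degree (smult (1/2) q) \<le> 2 * n - 1" using q(1) by auto
      show "\<exists>q. degree q \<le> 2 * n - 1 \<and> (\<forall>s. poly q s = P (sum_prod (s, t)) / 2)"
        using deg q(2) by (intro exI[of _ "smult (1/2) q"]) simp
      show "\<exists>q. degree q \<le> 2 * n - 1 \<and> (\<forall>s. poly q s = P (sum_prod (t, s)) / 2)"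
        using deg q(3) by (intro exI[of _ "smult (1/2) q"]) simp
    qed
    then have half: "has_bochner_integral lborel
        (\<lambda>z. P (sum_prod z) / 2 * (weight0 w (fst z) * weight0 w (snd z)))
        (\<Sum>(j, k)\<in>{1..n} \<times> {1..n}. christoffel j * christoffel k / 2 * P (node x j k))"
      by (simp add: sum_prod_def node_def)
    have [measurable]: "P \<in> borel_measurable borel"
      by (rule borel_measurable_continuous_onI[OF continuous_Pi2[OF P]])
    have "has_bochner_integral lborel (\<lambda>z. P (sum_prod z) * pullback_weight w (- 1 / 2) z)
        (\<Sum>(j, k)\<in>{1..n} \<times> {1..n}. christoffel j * christoffel k / 2 * P (node x j k))"
    proof (rule has_bochner_integral_cong_AE[THEN iffD1, OF _ _ _ half])
      show "(\<lambda>z. P (sum_prod z) / 2 * (weight0 w (fst z) * weight0 w (snd z)))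
          \<in> borel_measurable lborel"
        using half by (rule borel_measurable_has_bochner_integral)
      show "(\<lambda>z. P (sum_prod z) * pullback_weight w (- 1 / 2) z) \<in> borel_measurable lborel"
        using pullback_weight_measurable[OF weight] by measurable
      show "AE z in lborel. P (sum_prod z) / 2 * (weight0 w (fst z) * weight0 w (snd z)) =
          P (sum_prod z) * pullback_weight w (- 1 / 2) z"
        using AE_off_diagonal
      proof eventually_elim
        case (elim z)
        have "((fst z - snd z)\<^sup>2) powr (- 1 / 2) * \<bar>fst z - snd z\<bar> = 1"
          using elim by (simp add: powr_minus powr_half_sqrt)
        then show ?case
          by (simp add: pullback_weight_def)
      qed
    qed
    then show "has_bochner_integral lborel (\<lambda>z. P z * W_unnormalized w (- 1 / 2) z)
        (\<Sum>(j, k)\<in>{1..n} \<times> {1..n}. christoffel j * christoffel k / 2 * P (node x j k))"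
      by (rule has_bochner_integral_W_unnormalized[OF weight, rotated]) measurable
  qed (use pos christoffel_pos in auto)
  with card show ?thesis unfolding gaussian_nodes_def by blast
qed

text \<open>The pullback of \<open>W\<^bsub>1/2\<^esub>\<close> carries the factor \<open>(x - y)\<^sup>2 / 2\<close>. It raises the degree in each
  variable by two, which the product rule of degree \<open>2 n - 1\<close> can absorb, and it removes the
  nodes on the diagonal.\<close>

lemma gaussian_nodes_plus:
  "gaussian_nodes (W w (1 / 2)) (n - 1) {node x j k | j k. 1 \<le> j \<and> j < k \<and> k \<le> n}"
  (is "gaussian_nodes _ _ ?S")
proof -
  have "?S = (\<lambda>(k, j). node x j k) ` (SIGMA k:{1..n}. {1..<k})"
    by force
  moreover have "inj_on (\<lambda>(k, j). node x j k) (SIGMA k:{1..n}. {1..<k})"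
    by (rule inj_onI) (auto simp: node_eq_iff)
  ultimately have "card ?S = (\<Sum>k=1..n. k - 1)"
    by (simp add: card_image card_SigmaI)
  also have "\<dots> = (n - 1) * (n - 1 + 1) div 2"
  proof (induction n)
    case (Suc m)
    then show ?case by (cases m) auto
  qed simp
  finally have card: "card ?S = (n - 1) * (n - 1 + 1) div 2" .
  define I where "I = {(j, k). j \<in> {1..n} \<and> k \<in> {1..n} \<and> j \<noteq> k}"
  have I: "I \<subseteq> {1..n} \<times> {1..n}" by (auto simp: I_def)
  have S: "?S = (\<lambda>(j, k). node x j k) ` I"
  proof (intro equalityI subsetI)
    fix s assume "s \<in> (\<lambda>(j, k). node x j k) ` I"
    then obtain j k where jk: "s = node x j k" "j \<in> {1..n}" "k \<in> {1..n}" "j \<noteq> k"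
      by (auto simp: I_def)
    moreover have "node x j k = node x k j" by (simp add: node_def)
    ultimately show "s \<in> ?S"
      by (cases "j < k") (force intro: exI[of _ j] exI[of _ k])+
  qed (force simp: I_def)
  have "\<exists>a. cubature_rule (W w (1 / 2)) (2 * int (n - 1) - 1) ?S a"
  proof (rule cubature_rule_from_product
      [where b = "\<lambda>j k. christoffel j * christoffel k * ((x j - x k)\<^sup>2 / 2)", OF _ _ S])
    show "finite I" using I by (rule finite_subset) simp
    show "0 \<le> 2 * int (n - 1) - 1" if "I \<noteq> {}"
      using that by (auto simp: I_def)
    show "0 < christoffel j * christoffel k * ((x j - x k)\<^sup>2 / 2)" if "(j, k) \<in> I" for j k
    proof -
      have "j \<in> {1..n}" "k \<in> {1..n}" "j \<noteq> k" using that by (auto simp: I_def)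
      then have "0 < christoffel j" "0 < christoffel k" "x j \<noteq> x k"
        using christoffel_pos inj_onD[OF inj_nodes] by blast+
      then show ?thesis by simp
    qed
  next
    fix P assume P: "P \<in> Pi2 (2 * int (n - 1) - 1)"
    let ?Q = "\<lambda>z. (fst z - snd z)\<^sup>2 / 2 * P (sum_prod z)"
    have cont: "continuous_on UNIV ?Q"
      unfolding sum_prod_def
      by (intro continuous_intros continuous_on_compose2[OF continuous_Pi2[OF P]]) auto
    have "has_bochner_integral lborel (\<lambda>z. ?Q z * (weight0 w (fst z) * weight0 w (snd z)))
        (\<Sum>(j, k)\<in>{1..n} \<times> {1..n}. christoffel j * christoffel k * ?Q (x j, x k))"
    proof (rule product_quadrature[OF cont])
      fix t
      obtain q where q: "int (degree q) \<le> 2 * int (n - 1) - 1 \<or> q = 0"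
        "\<And>s. poly q s = P (sum_prod (s, t))" "\<And>s. poly q s = P (sum_prod (t, s))"
        using Pi2_sum_prod_slices[OF P, of t] by blast
      define r where "r = smult (1 / 2) ([:- t, 1:]\<^sup>2 * q)"
      have deg: "degree r \<le> 2 * n - 1"
      proof (cases "q = 0")
        case False
        have "degree ([:- t, 1:]\<^sup>2 * q) \<le> 2 + degree q"
          using degree_mult_le[of "[:- t, 1:]\<^sup>2" q] by (simp add: degree_linear_power)
        then show ?thesis unfolding r_def using q(1) False pos by auto
      qed (simp add: r_def)
      have r: "poly r s = (s - t)\<^sup>2 / 2 * poly q s" for s
        by (simp add: r_def)
      show "\<exists>q. degree q \<le> 2 * n - 1 \<and> (\<forall>s. poly q s = ?Q (s, t))"
        using deg q(2) by (intro exI[of _ r]) (simp add: r)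
      show "\<exists>q. degree q \<le> 2 * n - 1 \<and> (\<forall>s. poly q s = ?Q (t, s))"
        using deg q(3) by (intro exI[of _ r]) (simp add: r power2_commute)
    qed
    also have "(\<lambda>z. ?Q z * (weight0 w (fst z) * weight0 w (snd z))) =
        (\<lambda>z. P (sum_prod z) * pullback_weight w (1 / 2) z)"
      by (auto simp: pullback_weight_def powr_half_sqrt power2_eq_square fun_eq_iff)
    also have "(\<Sum>(j, k)\<in>{1..n} \<times> {1..n}. christoffel j * christoffel k * ?Q (x j, x k)) =
        (\<Sum>(j, k)\<in>I. christoffel j * christoffel k * ((x j - x k)\<^sup>2 / 2) * P (node x j k))"
      using I by (intro sum.mono_neutral_cong_right) (auto simp: I_def sum_prod_def node_def)
    finally show "has_bochner_integral lborel (\<lambda>z. P z * W_unnormalized w (1 / 2) z)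
        (\<Sum>(j, k)\<in>I. christoffel j * christoffel k * ((x j - x k)\<^sup>2 / 2) * P (node x j k))"
      by (rule has_bochner_integral_W_unnormalized[OF weight, rotated])
        (rule borel_measurable_continuous_onI[OF continuous_Pi2[OF P]])
  qed
  with card show ?thesis unfolding gaussian_nodes_def by blast
qed

section \<open>Interpolation at the nodes\<close>

text \<open>A function that is a polynomial of degree less than \<open>n\<close> in each variable is determined by
  its values on the grid of all \<open>(x j, x k)\<close>.\<close>

lemma zero_on_grid:
  assumes slice1: "\<And>t. \<exists>q. degree q < n \<and> (\<forall>s. poly q s = Q (s, t))"
    and slice2: "\<And>s. \<exists>q. degree q < n \<and> (\<forall>t. poly q t = Q (s, t))"
    and grid: "\<And>j k. j \<in> {1..n} \<Longrightarrow> k \<in> {1..n} \<Longrightarrow> Q (x j, x k) = 0"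
  shows "Q (s, t) = 0"
proof -
  have line: "Q (s, x k) = 0" if "k \<in> {1..n}" for k
  proof -
    obtain q where "degree q < n" "\<And>s. poly q s = Q (s, x k)" using slice1 by blast
    with poly_eq_on_nodes[of q 0] grid that pos show ?thesis by (metis degree_0 poly_0)
  qed
  obtain q where "degree q < n" "\<And>t. poly q t = Q (s, t)" using slice2 by blast
  with poly_eq_on_nodes[of q 0] line pos show ?thesis by (metis degree_0 poly_0)
qed

lemma Pi2_eq_0_if_nodes_le:
  assumes P: "P \<in> Pi2 (int n - 1)"
    and zero: "\<And>j k. 1 \<le> j \<Longrightarrow> j \<le> k \<Longrightarrow> k \<le> n \<Longrightarrow> P (node x j k) = 0"
  shows "P = (\<lambda>_. 0)"
proof (rule Pi2_eq_0[OF P])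
  fix s t
  have "P (sum_prod (s, t)) = 0"
  proof (rule zero_on_grid)
    fix t
    obtain q where q: "int (degree q) \<le> int n - 1 \<or> q = 0"
      "\<And>s. poly q s = P (sum_prod (s, t))" "\<And>s. poly q s = P (sum_prod (t, s))"
      using Pi2_sum_prod_slices[OF P, of t] by blast
    then have "degree q < n" using pos by auto
    with q show "\<exists>q. degree q < n \<and> (\<forall>s. poly q s = P (sum_prod (s, t)))"
      "\<exists>q. degree q < n \<and> (\<forall>s. poly q s = P (sum_prod (t, s)))" by blast+
  next
    fix j k assume "j \<in> {1..n}" "k \<in> {1..n}"
    then show "P (sum_prod (x j, x k)) = 0"
      using zero[of j k] zero[of k j]
      by (cases "j \<le> k") (auto simp: sum_prod_def node_def add.commute mult.commute)
  qed
  then show "P (s + t, s * t) = 0" by (simp add: sum_prod_def)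
qed

text \<open>Multiplying by \<open>x - y\<close> supplies zeros at the diagonal grid points at the cost of one degree
  in each variable.\<close>

lemma Pi2_eq_0_if_nodes_less:
  assumes P: "P \<in> Pi2 (int n - 2)"
    and zero: "\<And>j k. 1 \<le> j \<Longrightarrow> j < k \<Longrightarrow> k \<le> n \<Longrightarrow> P (node x j k) = 0"
  shows "P = (\<lambda>_. 0)"
proof (rule Pi2_eq_0[OF P])
  fix s t :: real assume "s \<noteq> t"
  let ?Q = "\<lambda>z. (fst z - snd z) * P (sum_prod z)"
  have "?Q (s, t) = 0"
  proof (rule zero_on_grid)
    fix t
    obtain q where q: "int (degree q) \<le> int n - 2 \<or> q = 0"
      "\<And>s. poly q s = P (sum_prod (s, t))" "\<And>s. poly q s = P (sum_prod (t, s))"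
      using Pi2_sum_prod_slices[OF P, of t] by blast
    define r where "r = [:- t, 1:] * q"
    have deg: "degree r < n"
    proof (cases "q = 0")
      case False
      have "degree r \<le> 1 + degree q"
        unfolding r_def using degree_mult_le[of "[:- t, 1:]" q] by simp
      then show ?thesis using q(1) False by auto
    qed (simp add: r_def pos)
    have r: "poly r s = (s - t) * poly q s" for s
      by (simp add: r_def algebra_simps)
    show "\<exists>q. degree q < n \<and> (\<forall>s. poly q s = ?Q (s, t))"
      using deg q(2) by (intro exI[of _ r]) (simp add: r)
    show "\<exists>q. degree q < n \<and> (\<forall>s. poly q s = ?Q (t, s))"
      using deg q(3) by (intro exI[of _ "- r"]) (simp add: r algebra_simps)
  next
    fix j k assume "j \<in> {1..n}" "k \<in> {1..n}"
    then show "?Q (x j, x k) = 0"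
      using zero[of j k] zero[of k j]
      by (cases j k rule: linorder_cases)
        (auto simp: sum_prod_def node_def add.commute mult.commute)
  qed
  then show "P (s + t, s * t) = 0" using \<open>s \<noteq> t\<close> by (simp add: sum_prod_def)
qed

lemma unique_interpolant:
  assumes "lagrange_interpolant m S f P"
    and zero: "\<And>Q. Q \<in> Pi2 m \<Longrightarrow> (\<And>s. s \<in> S \<Longrightarrow> Q s = 0) \<Longrightarrow> Q = (\<lambda>_. 0)"
  shows "\<exists>!P. lagrange_interpolant m S f P"
proof (rule ex1I)
  show "lagrange_interpolant m S f P" by (rule assms(1))
next
  fix P' assume "lagrange_interpolant m S f P'"
  then have "(\<lambda>z. P' z - P z) = (\<lambda>_. 0)"
    using assms(1) unfolding lagrange_interpolant_def
    by (intro zero Pi2_diff) auto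
  then show "P' = P" by (simp add: fun_eq_iff)
qed

lemma interpolation_minus:
  defines "S \<equiv> {node x j k | j k. 1 \<le> j \<and> j \<le> k \<and> k \<le> n}"
  shows "\<exists>l. (\<forall>k\<in>{1..n}. \<forall>j\<in>{1..k}. l j k \<in> Pi2 (int n - 1) \<and>
      (\<forall>s t. l j k (s + t, s * t) = l_plus p x j k s t)) \<and>
    (\<forall>f. (\<exists>!P. lagrange_interpolant (int n - 1) S f P) \<and>
      lagrange_interpolant (int n - 1) S f
        (\<lambda>z. \<Sum>k=1..n. \<Sum>j=1..k. (if j = k then 1 / 2 else 1) * (f (node x j k) * l j k z)))"
proof -
  have "\<exists>P\<in>Pi2 (int n - 1). \<forall>s t. P (s + t, s * t) = l_plus p x j k s t"
    if "j \<in> {1..n}" "k \<in> {1..n}" for j k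
    using symmetrization_in_Pi2[OF degree_fund[OF that(1)] degree_fund[OF that(2)]] pos
    by (simp add: l_plus_def fund_def of_nat_diff)
  then obtain l where l: "\<And>j k. j \<in> {1..n} \<Longrightarrow> k \<in> {1..n} \<Longrightarrow> l j k \<in> Pi2 (int n - 1)"
    "\<And>j k s t. j \<in> {1..n} \<Longrightarrow> k \<in> {1..n} \<Longrightarrow> l j k (s + t, s * t) = l_plus p x j k s t"
    by metis
  have interp: "lagrange_interpolant (int n - 1) S f
      (\<lambda>z. \<Sum>k=1..n. \<Sum>j=1..k. (if j = k then 1 / 2 else 1) * (f (node x j k) * l j k z))" for f
    unfolding lagrange_interpolant_def
  proof (intro conjI ballI Pi2_sum Pi2_scale l)
    fix s assume "s \<in> S"
    then obtain a b where s: "s = node x a b" and ab: "1 \<le> a" "a \<le> b" "b \<le> n"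
      by (auto simp: S_def)
    have val: "(if j = k then 1 / 2 else 1) * (f (node x j k) * l j k s) =
        (if k = b \<and> j = a then f s else 0)" if "k \<in> {1..n}" "j \<in> {1..k}" for j k
      using that ab fund_at_node[of a j] fund_at_node[of b j] fund_at_node[of a k] fund_at_node[of b k]
      unfolding s node_def l(2)[of j k] l_plus_def fund_def
      by (subst l(2)) (auto simp: l_plus_def)
    have "(\<Sum>k=1..n. \<Sum>j=1..k. (if j = k then 1 / 2 else 1) * (f (node x j k) * l j k s)) =
        (\<Sum>k=1..n. \<Sum>j=1..k. if k = b \<and> j = a then f s else 0)"
      using val by (intro sum.cong) auto
    also have "\<dots> = (\<Sum>k=1..n. if k = b then f s else 0)"
      using ab by (intro sum.cong) (auto simp: sum.delta)
    finally show "(\<Sum>k=1..n. \<Sum>j=1..k. (if j = k then 1 / 2 else 1) * (f (node x j k) * l j k s)) = f s"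
      using ab by simp
  qed auto
  have "\<exists>!P. lagrange_interpolant (int n - 1) S f P" for f
  proof (rule unique_interpolant[OF interp])
    fix Q assume Q: "Q \<in> Pi2 (int n - 1)" and zero: "\<And>s. s \<in> S \<Longrightarrow> Q s = 0"
    show "Q = (\<lambda>_. 0)"
      by (rule Pi2_eq_0_if_nodes_le[OF Q], rule zero) (auto simp: S_def)
  qed
  with interp l show ?thesis
    by (intro exI[of _ l]) auto
qed

lemma interpolation_plus:
  defines "S \<equiv> {node x j k | j k. 1 \<le> j \<and> j < k \<and> k \<le> n}"
  shows "\<exists>l. (\<forall>k\<in>{2..n}. \<forall>j\<in>{1..k-1}. l j k \<in> Pi2 (int n - 2) \<and>
      (\<forall>s t. s \<noteq> t \<longrightarrow> l j k (s + t, s * t) = l_minus p x j k s t)) \<and>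
    (\<forall>f. (\<exists>!P. lagrange_interpolant (int n - 2) S f P) \<and>
      lagrange_interpolant (int n - 2) S f
        (\<lambda>z. \<Sum>k=2..n. \<Sum>j=1..k-1. f (node x j k) * l j k z))"
proof -
  have "\<exists>P\<in>Pi2 (int n - 2). \<forall>s t. s \<noteq> t \<longrightarrow> P (s + t, s * t) = l_minus p x j k s t"
    if jk: "j \<in> {1..n}" "k \<in> {1..n}" for j k
  proof -
    have "int (n - 1) - 1 = int n - 2" using pos by simp
    then obtain P where P: "P \<in> Pi2 (int n - 2)" "\<And>s t. (s - t) * P (s + t, s * t) =
        poly (fund j) s * poly (fund k) t - poly (fund j) t * poly (fund k) s"
      using antisymmetrization_in_Pi2[OF degree_fund[OF jk(1)] degree_fund[OF jk(2)]] by metis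
    have "(x j - x k) * P (s + t, s * t) = l_minus p x j k s t" if "s \<noteq> t" for s t
      using P(2)[of s t] that unfolding l_minus_def fund_def by (simp add: nonzero_eq_divide_eq mult.commute)
    then show ?thesis
      using Pi2_scale[OF P(1)] by (intro bexI[of _ "\<lambda>z. (x j - x k) * P z"]) auto
  qed
  then obtain l where l: "\<And>j k. j \<in> {1..n} \<Longrightarrow> k \<in> {1..n} \<Longrightarrow> l j k \<in> Pi2 (int n - 2)"
    "\<And>j k s t. j \<in> {1..n} \<Longrightarrow> k \<in> {1..n} \<Longrightarrow> s \<noteq> t \<Longrightarrow>
      l j k (s + t, s * t) = l_minus p x j k s t"
    by metis
  have interp: "lagrange_interpolant (int n - 2) S f
      (\<lambda>z. \<Sum>k=2..n. \<Sum>j=1..k-1. f (node x j k) * l j k z)" for f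
    unfolding lagrange_interpolant_def
  proof (intro conjI ballI Pi2_sum Pi2_scale l)
    fix s assume "s \<in> S"
    then obtain a b where s: "s = node x a b" and ab: "1 \<le> a" "a < b" "b \<le> n"
      by (auto simp: S_def)
    have "x a \<noteq> x b" using inj_nodes ab by (auto dest: inj_onD)
    have val: "f (node x j k) * l j k s = (if k = b \<and> j = a then f s else 0)"
      if "k \<in> {2..n}" "j \<in> {1..k-1}" for j k
    proof -
      have "l j k s = l_minus p x j k (x a) (x b)"
        unfolding s node_def using that \<open>x a \<noteq> x b\<close> by (intro l) auto
      also have "\<dots> = (if k = b \<and> j = a then 1 else 0)"
      proof -
        have mem: "j \<in> {1..n}" "k \<in> {1..n}" "a \<in> {1..n}" "b \<in> {1..n}" and "j < k"
          using that ab by auto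
        show ?thesis
          unfolding l_minus_def fund_def[symmetric]
            fund_at_node[OF mem(3) mem(1)] fund_at_node[OF mem(4) mem(1)]
            fund_at_node[OF mem(3) mem(2)] fund_at_node[OF mem(4) mem(2)]
          using \<open>j < k\<close> \<open>a < b\<close> \<open>x a \<noteq> x b\<close> by auto
      qed
      finally show ?thesis by (simp add: s)
    qed
    have "(\<Sum>k=2..n. \<Sum>j=1..k-1. f (node x j k) * l j k s) =
        (\<Sum>k=2..n. \<Sum>j=1..k-1. if k = b \<and> j = a then f s else 0)"
      using val by (intro sum.cong) auto
    also have "\<dots> = (\<Sum>k=2..n. if k = b then f s else 0)"
      using ab by (intro sum.cong) (auto simp: sum.delta)
    finally show "(\<Sum>k=2..n. \<Sum>j=1..k-1. f (node x j k) * l j k s) = f s"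
      using ab by simp
  qed auto
  have "\<exists>!P. lagrange_interpolant (int n - 2) S f P" for f
  proof (rule unique_interpolant[OF interp])
    fix Q assume Q: "Q \<in> Pi2 (int n - 2)" and zero: "\<And>s. s \<in> S \<Longrightarrow> Q s = 0"
    show "Q = (\<lambda>_. 0)"
      by (rule Pi2_eq_0_if_nodes_less[OF Q], rule zero) (auto simp: S_def)
  qed
  with interp l show ?thesis
    by (intro exI[of _ l]) auto
qed

end

section \<open>The interpolation theorem\<close>

theorem theorem5p1:
  fixes w :: "real \<Rightarrow> real" and n :: nat and p :: "real poly" and x :: "nat \<Rightarrow> real"
  assumes "weight_function w"
    and "0 < n"
    and "orthogonal_poly w n p"
    and "x ` {1..n} = {t. poly p t = 0}"
  shows
    "(let S = {node x j k | j k. 1 \<le> j \<and> j \<le> k \<and> k \<le> n} in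
       gaussian_nodes (W w (- 1 / 2)) n S \<and>
       (\<exists>l. (\<forall>k\<in>{1..n}. \<forall>j\<in>{1..k}. l j k \<in> Pi2 (int n - 1) \<and>
                (\<forall>s t. l j k (s + t, s * t) = l_plus p x j k s t)) \<and>
            (\<forall>f. (\<exists>!P. lagrange_interpolant (int n - 1) S f P) \<and>
                 lagrange_interpolant (int n - 1) S f
                   (\<lambda>z. \<Sum>k=1..n. \<Sum>j=1..k.
                      (if j = k then 1 / 2 else 1) * (f (node x j k) * l j k z))))) \<and>
     (let S = {node x j k | j k. 1 \<le> j \<and> j < k \<and> k \<le> n} in
       gaussian_nodes (W w (1 / 2)) (n - 1) S \<and>
       (\<exists>l. (\<forall>k\<in>{2..n}. \<forall>j\<in>{1..k-1}. l j k \<in> Pi2 (int n - 2) \<and>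
                (\<forall>s t. s \<noteq> t \<longrightarrow> l j k (s + t, s * t) = l_minus p x j k s t)) \<and>
            (\<forall>f. (\<exists>!P. lagrange_interpolant (int n - 2) S f P) \<and>
                 lagrange_interpolant (int n - 2) S f
                   (\<lambda>z. \<Sum>k=2..n. \<Sum>j=1..k-1. f (node x j k) * l j k z))))"
proof -
  interpret orthogonal_zeros w n p x
    using assms by unfold_locales
  show ?thesis
    unfolding Let_def
    using gaussian_nodes_minus interpolation_minus gaussian_nodes_plus interpolation_plus
    by blast
qed

end
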